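(* Let $n\geq 2$, let $A\in\mathbb{Z}^{m\times n}$ be an integral matrix of full column rank, let $b\in\mathbb{Z}^m$ and $c\in\mathbb{Q}^n$. Let $x^*$ be an optimal vertex of the linear program $\max\{c^\top x : Ax\le b,\ x\in\mathbb{R}^n\}$. If the integer program $\max\{c^\top x : Ax\le b,\ x\in\mathbb{Z}^n\}$ is feasible, then it has an optimal solution $z^*$ such that \[ \|x^*-z^*\|_\infty<\frac{4n+2}{9}\cdot\Delta_{n-1}(A). \]
   Context: For $k\in\{1,\dots,n\}$, $\Delta_k(A)$ denotes the maximum of $|\det M|$ over all $k\times k$ submatrices $M$ of $A$. *)

theory Defs
  imports "Jordan_Normal_Form.DL_Rank_Submatrix" "Jordan_Normal_Form.Determinant"
begin

definition Delta :: "nat \<Rightarrow> int mat \<Rightarrow> int" where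
  "Delta k A = Max {\<bar>det (submatrix A I J)\<bar> | I J.
      I \<subseteq> {..<dim_row A} \<and> J \<subseteq> {..<dim_col A} \<and> card I = k \<and> card J = k}"

definition polyhedron :: "int mat \<Rightarrow> int vec \<Rightarrow> real vec set" where
  "polyhedron A b = {x \<in> carrier_vec (dim_col A).
      \<forall>i < dim_row A. (map_mat real_of_int A *\<^sub>v x) $ i \<le> real_of_int (b $ i)}"

definition is_vertex :: "real vec set \<Rightarrow> real vec \<Rightarrow> bool" where
  "is_vertex P x \<longleftrightarrow> x \<in> P \<and>
     \<not> (\<exists>y\<in>P. \<exists>z\<in>P. y \<noteq> z \<and> (\<exists>t::real. 0 < t \<and> t < 1 \<and>
          x = t \<cdot>\<^sub>v y + (1 - t) \<cdot>\<^sub>v z))"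

definition lp_optimal :: "int mat \<Rightarrow> int vec \<Rightarrow> rat vec \<Rightarrow> real vec \<Rightarrow> bool" where
  "lp_optimal A b c x \<longleftrightarrow> x \<in> polyhedron A b \<and>
     (\<forall>y \<in> polyhedron A b. map_vec real_of_rat c \<bullet> y \<le> map_vec real_of_rat c \<bullet> x)"

definition ip_feasible :: "int mat \<Rightarrow> int vec \<Rightarrow> int vec \<Rightarrow> bool" where
  "ip_feasible A b z \<longleftrightarrow> z \<in> carrier_vec (dim_col A) \<and> map_vec real_of_int z \<in> polyhedron A b"

definition ip_optimal :: "int mat \<Rightarrow> int vec \<Rightarrow> rat vec \<Rightarrow> int vec \<Rightarrow> bool" where
  "ip_optimal A b c z \<longleftrightarrow> ip_feasible A b z \<and>
     (\<forall>w. ip_feasible A b w \<longrightarrow>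
        map_vec real_of_rat c \<bullet> map_vec real_of_int w \<le> map_vec real_of_rat c \<bullet> map_vec real_of_int z)"

definition linf_norm :: "real vec \<Rightarrow> real" where
  "linf_norm v = Max (insert 0 {\<bar>v $ i\<bar> | i. i < dim_vec v})"

end

theory Submission
  imports
    "HOL-Analysis.Analysis"
    "HOL-Library.Function_Algebras"
    "Jordan_Normal_Form.Column_Operations"
    Defs
begin

unbundle no vec_syntax and no inner_syntax

text \<open>
  Let $u = x^* - z^*$, where $z^*$ is an optimal integer point with least total slack in the
  constraints tight at $x^*$, and change the signs of the rows $a_i$ of $A$ so that $a_i u \ge 0$.
  If $0 \le a_i f \le a_i u$ for all $i$, then no nonzero integer vector has the form $q + t f$ with
  $0 \le t \le 1$ and $|a_i q| < 1$ for all $i$: as $b$ is integral, adding it to $z^*$ would give an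
  optimal point with smaller slack.

  If such an $f$ lies in a face of dimension $k$ of the cone $a_i y \ge 0$, a packing argument in the
  span of that face bounds its coordinates by $\Delta_{n-1}$ for $k = 2$ and by
  $\frac{4}{3} \Delta_{n-1}$ for $k = 3$. The latter rests on the fact that a polygon
  $\{v : |p v| \le 1\}$, with $p$ ranging over a spanning set all of whose $2 \times 2$ determinants
  are at most $1$ in absolute value, has area at least $3$. Finally $u$ is written as a sum of vectors
  from faces of dimensions $2$ and $3$ with total dimension $n$.
\<close>

text \<open>The quantity bounded throughout is \<alpha> f, where \<alpha> is plus or minus a unit
  vector. A determinant with \<alpha> as one row and signed rows of A as the others becomes, on
  expansion along \<alpha>, a minor of order n - 1; hence \<Delta> of index n - 1 in the bound. Such
  determinants enter as lattice indices: points that are pairwise incongruent modulo the lattice are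
  at most as many as the determinant, and the packing produces one family of points for each integer
  height between 0 and \<alpha> f. Where rows are free to be chosen they maximise the determinant,
  which keeps the Cramer coefficients of all other rows small. In dimension 2 the cross-section at a
  fixed height is a line, and one point per height loses nothing. In dimension 3 it is a plane; a
  half-size polygon of area at least 3/4 costs the factor 4/3. Triples cost 4/9 per dimension
  against 1/2 for pairs, and 4 = 2 + 2, with cost 2 = (4*4 + 2)/9, fixes the additive constant.
  Vectors are functions on the naturals and n is a term, so ranks are counted by \<open>dim\<close>
  and \<open>span\<close> of real vector spaces.\<close>

instantiation "fun" :: (type, real_vector) real_vector
begin

definition scaleR_fun_def: "r *\<^sub>R f = (\<lambda>x. r *\<^sub>R f x)"

instance
  by standard (auto simp: scaleR_fun_def fun_eq_iff scaleR_add_right scaleR_add_left)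

end

lemma scaleR_fun_apply [simp]: "(r *\<^sub>R f) x = r *\<^sub>R f x"
  by (simp add: scaleR_fun_def)

subsection \<open>Ranks of finite sets of vectors\<close>

text \<open>Finiteness of \<open>B\<close> stands in for finite dimension of the ambient space,
  which functions on the naturals do not have.\<close>

lemma dim_mono_finite:
  fixes B :: "'a::real_vector set"
  assumes "finite B" "A \<subseteq> span B"
  shows "dim A \<le> dim B"
proof -
  obtain C where C: "C \<subseteq> B" "independent C" "B \<subseteq> span C" "card C = dim B"
    using basis_exists by blast
  have "A \<subseteq> span C"
    using assms(2) C(3) by (meson span_minimal subspace_span subset_trans)
  with C assms show ?thesis
    by (metis dim_le_card finite_subset)
qed

lemma dim_insert_le:
  fixes B :: "'a::real_vector set"
  assumes "finite B"
  shows "dim (insert x B) \<le> dim B + 1"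
proof -
  obtain C where C: "C \<subseteq> B" "independent C" "B \<subseteq> span C" "card C = dim B"
    using basis_exists by blast
  have fC: "finite C" using C(1) assms finite_subset by blast
  have "insert x B \<subseteq> span (insert x C)"
    using C(3) by (auto intro: span_base span_mono[THEN subsetD, of C])
  then have "dim (insert x B) \<le> card (insert x C)"
    using fC by (intro dim_le_card) auto
  also have "\<dots> \<le> card C + 1" using fC by (simp add: card_insert_if)
  finally show ?thesis using C by simp
qed

text \<open>Extend a basis of \<open>Z\<close> to bases of \<open>X\<close> and of \<open>Y\<close>:
  together they span the union, and they share at least the basis of \<open>Z\<close>.\<close>

lemma dim_submodular:
  fixes X Y Z :: "'a::real_vector set"
  assumes "finite X" "finite Y" "Z \<subseteq> X" "Z \<subseteq> Y"
  shows "dim (X \<union> Y) + dim Z \<le> dim X + dim Y"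
proof -
  obtain C where C: "C \<subseteq> Z" "independent C" "Z \<subseteq> span C" "card C = dim Z"
    using basis_exists by blast
  obtain B1 where B1: "C \<subseteq> B1" "B1 \<subseteq> X" "independent B1" "X \<subseteq> span B1"
    using maximal_independent_subset_extend[of C X] C assms by blast
  obtain B2 where B2: "C \<subseteq> B2" "B2 \<subseteq> Y" "independent B2" "Y \<subseteq> span B2"
    using maximal_independent_subset_extend[of C Y] C assms by blast
  have fin: "finite B1" "finite B2" using B1 B2 assms finite_subset by blast+
  have "X \<union> Y \<subseteq> span (B1 \<union> B2)"
    using B1(4) B2(4) by (meson Un_least Un_upper1 Un_upper2 span_mono subset_trans)
  then have "dim (X \<union> Y) \<le> card (B1 \<union> B2)"
    using fin by (intro dim_le_card) auto
  moreover have "card (B1 \<union> B2) + card (B1 \<inter> B2) = card B1 + card B2"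
    using fin card_Un_Int by fastforce
  moreover have "card C \<le> card (B1 \<inter> B2)"
    using fin B1 B2 by (intro card_mono) auto
  moreover have "dim X = card B1" "dim Y = card B2"
    using basis_card_eq_dim B1 B2 by metis+
  ultimately show ?thesis using C(4) by simp
qed

subsection \<open>Families of linear functionals on the first $n$ coordinates\<close>

text \<open>Vectors are functions on all naturals, but only the first \<open>n\<close> coordinates
  count; equality of vectors is therefore usually asserted for \<open>j<n\<close> only.\<close>

definition ip :: "nat \<Rightarrow> (nat \<Rightarrow> real) \<Rightarrow> (nat \<Rightarrow> real) \<Rightarrow> real" where
  "ip n a w = (\<Sum>j<n. a j * w j)"

definition full :: "nat \<Rightarrow> (nat \<Rightarrow> real) set \<Rightarrow> bool" where
  "full n X \<longleftrightarrow> (\<forall>w. (\<forall>x\<in>X. ip n x w = 0) \<longrightarrow> (\<forall>j<n. w j = 0))"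

lemma ip_add_right: "ip n a (v + w) = ip n a v + ip n a w"
  by (simp add: ip_def algebra_simps sum.distrib)

lemma ip_diff_right: "ip n a (v - w) = ip n a v - ip n a w"
  by (simp add: ip_def algebra_simps sum_subtractf)

lemma ip_scale_right: "ip n a (c *\<^sub>R w) = c * ip n a w"
  by (simp add: ip_def sum_distrib_left algebra_simps)

lemma ip_minus_right: "ip n a (- w) = - ip n a w"
  by (simp add: ip_def sum_negf)

lemma ip_add_left: "ip n (v + w) a = ip n v a + ip n w a"
  by (simp add: ip_def algebra_simps sum.distrib)

lemma ip_scale_left: "ip n (c *\<^sub>R w) a = c * ip n w a"
  by (simp add: ip_def sum_distrib_left algebra_simps)

lemma ip_minus_left: "ip n (- w) a = - ip n w a"
  by (simp add: ip_def sum_negf)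

lemma ip_zero_right [simp]: "ip n a 0 = 0"
  by (simp add: ip_def)

lemma ip_sum_left: "ip n (sum g I) w = (\<Sum>i\<in>I. ip n (g i) w)"
proof -
  have [simp]: "sum g I j = (\<Sum>i\<in>I. g i j)" for j
    by (induction I rule: infinite_finite_induct) auto
  show ?thesis
    by (simp add: ip_def sum_distrib_right) (rule sum.swap)
qed

lemmas ip_simps = ip_add_right ip_diff_right ip_scale_right ip_minus_right

lemma ip_cong: "(\<And>j. j < n \<Longrightarrow> v j = w j) \<Longrightarrow> ip n a v = ip n a w"
  by (simp add: ip_def)

lemma ip_eq_0_span:
  assumes "a \<in> span X" "\<And>x. x \<in> X \<Longrightarrow> ip n x w = 0"
  shows "ip n a w = 0"
  using assms(1)
proof (induction rule: span_induct_alt)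
  case base
  then show ?case by (simp add: ip_def)
next
  case (step c x y)
  have "ip n (c *\<^sub>R x + y) w = c * ip n x w + ip n y w"
    by (simp only: ip_add_left ip_scale_left)
  also have "\<dots> = 0" using step assms(2) by simp
  finally show ?case .
qed

lemma full_mono: "full n X \<Longrightarrow> X \<subseteq> Y \<Longrightarrow> full n Y"
  unfolding full_def by blast

lemma nontrivial_solution:
  assumes "finite X" "finite I" "card X < card (I :: nat set)"
  shows "\<exists>w :: nat \<Rightarrow> real. (\<forall>x\<in>X. (\<Sum>j\<in>I. x j * w j) = 0) \<and> (\<exists>j\<in>I. w j \<noteq> 0)"
  using assms
proof (induction "card X" arbitrary: X I rule: less_induct)
  case less
  show ?case
  proof (cases "\<exists>x\<in>X. \<exists>j\<in>I. x j \<noteq> 0")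
    case False
    have "I \<noteq> {}" using less.prems by auto
    with False show ?thesis by (intro exI[of _ "\<lambda>_. 1"]) auto
  next
    case True
    then obtain x j0 where x: "x \<in> X" "j0 \<in> I" "x j0 \<noteq> 0" by blast
    define el where "el y = (\<lambda>j. y j - (y j0 / x j0) * x j)" for y :: "nat \<Rightarrow> real"
    let ?X = "el ` (X - {x})" and ?I = "I - {j0}"
    have pos: "card X > 0" "card I > 0" using x less.prems card_gt_0_iff by blast+
    have cX: "card ?X \<le> card X - 1"
      using less.prems x card_image_le[of "X - {x}" el] by simp
    have cI: "card ?I = card I - 1" using x less.prems by simp
    have "\<exists>w. (\<forall>y\<in>?X. (\<Sum>j\<in>?I. y j * w j) = 0) \<and> (\<exists>j\<in>?I. w j \<noteq> 0)"
      using cX cI less.prems pos by (intro less.hyps) auto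
    then obtain w where w: "\<And>y. y \<in> X - {x} \<Longrightarrow> (\<Sum>j\<in>?I. el y j * w j) = 0" "\<exists>j\<in>?I. w j \<noteq> 0"
      by auto
    define s where "s = (\<Sum>j\<in>?I. x j * w j)"
    define w' where "w' = w(j0 := - s / x j0)"
    have split: "(\<Sum>j\<in>I. y j * w' j) = y j0 * (- s / x j0) + (\<Sum>j\<in>?I. y j * w j)" for y :: "nat \<Rightarrow> real"
    proof -
      have "(\<Sum>j\<in>I. y j * w' j) = y j0 * w' j0 + (\<Sum>j\<in>?I. y j * w' j)"
        using x less.prems by (intro sum.remove) auto
      also have "(\<Sum>j\<in>?I. y j * w' j) = (\<Sum>j\<in>?I. y j * w j)"
        by (intro sum.cong) (auto simp: w'_def)
      finally show ?thesis by (simp add: w'_def)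
    qed
    have "(\<Sum>j\<in>I. y j * w' j) = 0" if "y \<in> X" for y
    proof (cases "y = x")
      case True
      then show ?thesis using split[of x] x by (simp add: s_def)
    next
      case False
      have "0 = (\<Sum>j\<in>?I. el y j * w j)" using w(1) that False by simp
      also have "\<dots> = (\<Sum>j\<in>?I. y j * w j) - (y j0 / x j0) * s"
        unfolding s_def el_def sum_distrib_left sum_subtractf[symmetric]
        by (intro sum.cong) (auto simp: algebra_simps)
      finally show ?thesis using split[of y] by (simp add: field_simps)
    qed
    moreover have "\<exists>j\<in>I. w' j \<noteq> 0" using w(2) by (auto simp: w'_def)
    ultimately show ?thesis by blast
  qed
qed

lemma full_imp_dim_ge:
  assumes "finite X" "full n X"
  shows "dim X \<ge> n"
proof (rule ccontr)
  assume "\<not> dim X \<ge> n"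
  obtain C where C: "C \<subseteq> X" "independent C" "X \<subseteq> span C" "card C = dim X"
    using basis_exists by blast
  then have "finite C" "card C < card {..<n}"
    using assms \<open>\<not> dim X \<ge> n\<close> finite_subset by auto
  from nontrivial_solution[OF this(1) _ this(2)]
  obtain w where w: "\<And>x. x \<in> C \<Longrightarrow> ip n x w = 0" "\<exists>j<n. w j \<noteq> 0"
    by (auto simp: ip_def)
  have "\<forall>x\<in>X. ip n x w = 0" using ip_eq_0_span w(1) C(3) by blast
  with assms w show False unfolding full_def by blast
qed

text \<open>\<open>ip n\<close> ignores the coordinates from \<open>n\<close> on, whereas linear
  independence sees them; within this subspace ranks are at most \<open>n\<close>.\<close>

definition supp_in :: "nat \<Rightarrow> (nat \<Rightarrow> real) set" where
  "supp_in n = {a. \<forall>j\<ge>n. a j = 0}"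

lemma independent_card_le:
  assumes "independent X" "X \<subseteq> supp_in n"
  shows "finite X" "card X \<le> n"
proof -
  define e where "e i = (\<lambda>j. if j = i then 1 else 0 :: real)" for i :: nat
  have "a \<in> span (e ` {..<n})" if "a \<in> supp_in n" for a
  proof -
    have "a = (\<Sum>i<n. a i *\<^sub>R e i)"
    proof
      fix j
      have "(\<Sum>i<m. a i *\<^sub>R e i) j = (if j < m then a j else 0)" for m
        by (induction m) (auto simp: e_def less_Suc_eq)
      then show "a j = (\<Sum>i<n. a i *\<^sub>R e i) j" using that by (auto simp: supp_in_def)
    qed
    also have "\<dots> \<in> span (e ` {..<n})"
      by (intro span_sum span_scale span_base) auto
    finally show ?thesis .
  qed
  then have "X \<subseteq> span (e ` {..<n})" using assms by blast
  with assms(1) have *: "finite X \<and> card X \<le> card (e ` {..<n})"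
    by (intro independent_span_bound) auto
  then show "finite X" by simp
  have "card (e ` {..<n}) \<le> n" using card_image_le[of "{..<n}" e] by simp
  with * show "card X \<le> n" by simp
qed

text \<open>Take an admissible \<open>d\<close> with the most vanishing functionals. If these and
  \<theta> had a common kernel, moving along it would keep the value of \<theta> and, since
  \<open>G\<close> has full rank, could be continued until one more functional vanishes.\<close>

lemma extreme_ray:
  assumes fin: "finite G" and full: "full n G"
    and d0: "\<And>g. g \<in> G \<Longrightarrow> ip n g d0 \<ge> 0" "ip n \<theta> d0 > 0"
  shows "\<exists>d. (\<forall>g\<in>G. ip n g d \<ge> 0) \<and> ip n \<theta> d > 0 \<and> full n (insert \<theta> {g\<in>G. ip n g d = 0})"
proof -
  define Z where "Z d = {g\<in>G. ip n g d = 0}" for d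
  define P where "P d \<longleftrightarrow> (\<forall>g\<in>G. ip n g d \<ge> 0) \<and> ip n \<theta> d > 0" for d
  have "P d0" using d0 by (auto simp: P_def)
  moreover have "card (Z d) < Suc (card G)" for d
    using card_mono[of G "Z d"] fin by (auto simp: Z_def)
  ultimately obtain d where d: "P d" "\<And>d'. P d' \<Longrightarrow> card (Z d') \<le> card (Z d)"
    using arg_max_nat_lemma[of P d0 "\<lambda>d. card (Z d)" "Suc (card G)"] by blast
  have "full n (insert \<theta> (Z d))"
  proof (rule ccontr)
    assume "\<not> full n (insert \<theta> (Z d))"
    then obtain w0 where w0: "ip n \<theta> w0 = 0" "\<And>g. g \<in> Z d \<Longrightarrow> ip n g w0 = 0" "\<exists>j<n. w0 j \<noteq> 0"
      unfolding full_def by auto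
    obtain g0 where g0: "g0 \<in> G" "ip n g0 w0 \<noteq> 0" using full w0(3) unfolding full_def by blast
    \<comment> \<open>The sign makes \<open>g0\<close> decrease, so that the ratio test below runs
      over a nonempty set.\<close>
    define w where "w = (if ip n g0 w0 < 0 then w0 else - w0)"
    have w: "ip n \<theta> w = 0" "\<And>g. g \<in> Z d \<Longrightarrow> ip n g w = 0" "ip n g0 w < 0"
      using w0 g0 by (auto simp: w_def ip_minus_right)
    define X where "X = {g\<in>G. ip n g w < 0}"
    define r where "r g = ip n g d / (- ip n g w)" for g
    have X: "finite X" "X \<noteq> {}" using fin w g0 by (auto simp: X_def)
    define t where "t = Min (r ` X)"
    have "t \<in> r ` X" unfolding t_def using X by (intro Min_in) auto
    then obtain g1 where g1: "g1 \<in> X" "t = r g1" by blast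
    have tle: "t \<le> r g" if "g \<in> X" for g unfolding t_def using X that by auto
    have "t \<ge> 0" using g1 d(1) by (auto simp: r_def X_def P_def divide_nonneg_neg)
    have "P (d + t *\<^sub>R w)"
      unfolding P_def
    proof (intro conjI ballI)
      fix g assume g: "g \<in> G"
      show "0 \<le> ip n g (d + t *\<^sub>R w)"
      proof (cases "ip n g w < 0")
        case True
        then have "t \<le> r g" using tle g by (auto simp: X_def)
        with True show ?thesis by (simp add: r_def ip_simps field_simps)
      next
        case False
        then show ?thesis using g d(1) \<open>t \<ge> 0\<close> by (auto simp: P_def ip_simps)
      qed
    next
      show "ip n \<theta> (d + t *\<^sub>R w) > 0" using d(1) w by (auto simp: P_def ip_simps)
    qed
    then have "card (Z (d + t *\<^sub>R w)) \<le> card (Z d)" by (rule d(2))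
    moreover have "insert g1 (Z d) \<subseteq> Z (d + t *\<^sub>R w)"
      using w(2) g1 by (auto simp: Z_def ip_simps r_def X_def field_simps)
    moreover have "g1 \<notin> Z d" using g1 w(2)[of g1] by (auto simp: X_def)
    moreover have "finite (Z (d + t *\<^sub>R w))" using fin by (auto simp: Z_def)
    ultimately have "card (insert g1 (Z d)) \<le> card (Z d)" "finite (Z d)"
      by (meson card_mono finite_subset finite_insert order_trans)+
    then show False using \<open>g1 \<notin> Z d\<close> by simp
  qed
  with d(1) show ?thesis unfolding P_def Z_def by blast
qed

text \<open>The vertices $f$ of $C \cap (u - C)$ of small type, where the rank of the constraints tight at
  $u - f$ is too small, contain $0$ but not $u$. From one that maximises the sum of all the
  functionals, an improving edge leads to a vertex of large type; as the constraints tight along an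
  edge have rank $n - 1$, the type cannot jump over the required value.\<close>

lemma cone_splitting:
  assumes fin: "finite R" and fullR: "full n R" and u: "\<And>x. x \<in> R \<Longrightarrow> ip n x u \<ge> 0"
    and dimu: "dim {x\<in>R. ip n x u = 0} \<ge> n - d" and k: "k \<le> d" "d \<le> n"
  shows "\<exists>f. (\<forall>x\<in>R. 0 \<le> ip n x f \<and> ip n x f \<le> ip n x u) \<and>
    dim {x\<in>R. ip n x f = 0} \<ge> n - k \<and> dim {x\<in>R. ip n x (u - f) = 0} \<ge> n - (d - k)"
proof (rule ccontr)
  assume contr: "\<not> ?thesis"
  define T1 where "T1 f = {x\<in>R. ip n x f = 0}" for f
  define T2 where "T2 f = {x\<in>R. ip n x (u - f) = 0}" for f
  define S where "S = {f. \<forall>x\<in>R. 0 \<le> ip n x f \<and> ip n x f \<le> ip n x u}"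
  \<comment> \<open>Nonnegative on the cone, and zero there only if all of \<open>R\<close>
    vanishes; so \<open>u - f\<close> is an improving direction unless \<open>f\<close> agrees with
    \<open>u\<close> on \<open>R\<close>.\<close>
  define \<theta> where "\<theta> = \<Sum>R"
  \<comment> \<open>With the coordinates from \<open>n\<close> on set to 0, a vertex is determined
    by its two tight sets; this makes \<open>V\<close> finite. The same truncation recurs in
    \<open>f'\<close>.\<close>
  define V where "V = {f\<in>S. (\<forall>j\<ge>n. f j = 0) \<and> full n (T1 f \<union> T2 f)}"
  define low where "low f \<longleftrightarrow> dim (T2 f) < n - (d - k)" for f
  have finT: "finite (T1 f)" "finite (T2 f)" for f using fin by (auto simp: T1_def T2_def)
  have dR: "dim R \<ge> n" using full_imp_dim_ge fin fullR by blast
  have th: "ip n \<theta> w = (\<Sum>x\<in>R. ip n x w)" for w by (simp add: \<theta>_def ip_sum_left)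
  have high: "dim (T1 f) < n - k" if "f \<in> V" "\<not> low f" for f
    using contr that by (force simp: low_def V_def S_def T1_def T2_def)
  have "finite V"
  proof -
    have "inj_on (\<lambda>f. (T1 f, T2 f)) V"
    proof (rule inj_onI)
      fix f g assume fg: "f \<in> V" "g \<in> V" "(T1 f, T2 f) = (T1 g, T2 g)"
      have "ip n x (f - g) = 0" if "x \<in> T1 f \<union> T2 f" for x
        using that
      proof
        assume "x \<in> T1 f"
        then have "x \<in> T1 f" "x \<in> T1 g" using fg(3) by auto
        then show ?thesis by (simp add: T1_def ip_simps)
      next
        assume "x \<in> T2 f"
        then have "x \<in> T2 f" "x \<in> T2 g" using fg(3) by auto
        then show ?thesis by (simp add: T2_def ip_simps)
      qed
      then have "\<forall>j<n. (f - g) j = 0" using fg(1) unfolding V_def full_def by blast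
      then show "f = g" using fg(1,2) by (auto simp: V_def fun_eq_iff) (metis not_le)
    qed
    moreover have "(\<lambda>f. (T1 f, T2 f)) ` V \<subseteq> Pow R \<times> Pow R" by (auto simp: T1_def T2_def)
    ultimately show ?thesis using fin by (meson finite_SigmaI finite_Pow_iff inj_on_finite)
  qed
  have "T1 0 = R" by (auto simp: T1_def)
  have zero: "0 \<in> V" "low 0"
  proof -
    show 0: "0 \<in> V" using u full_mono[OF fullR] \<open>T1 0 = R\<close> by (auto simp: V_def S_def)
    show "low 0" using high[OF 0] dR \<open>T1 0 = R\<close> by force
  qed
  define L where "L = {f\<in>V. low f}"
  have L: "finite L" "L \<noteq> {}" using \<open>finite V\<close> zero by (auto simp: L_def)
  have "Max (ip n \<theta> ` L) \<in> ip n \<theta> ` L" using L by (intro Max_in) auto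
  then obtain f where f: "f \<in> L" "ip n \<theta> f = Max (ip n \<theta> ` L)" by force
  have fmax: "ip n \<theta> g \<le> ip n \<theta> f" if "g \<in> L" for g using f(2) that L(1) by auto
  have fV: "f \<in> V" "low f" "f \<in> S" using f(1) by (auto simp: L_def V_def)
  have "T2 f \<noteq> R" using fV(2) dR by (auto simp: low_def)
  then obtain x1 where x1: "x1 \<in> R" "ip n x1 (u - f) \<noteq> 0" by (auto simp: T2_def)
  have uf: "ip n x (u - f) \<ge> 0" "ip n x f \<ge> 0" if "x \<in> R" for x
    using fV(3) that by (auto simp: S_def ip_simps)
  have thuf: "ip n \<theta> (u - f) > 0"
    unfolding th using uf x1 by (intro sum_pos2[OF fin x1(1)]) force+
  \<comment> \<open>Directions that stay feasible at \<open>f\<close>: functionals at their lower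
    bound 0 may not decrease, those at their upper bound, the value in \<open>u\<close>, may not
    increase.\<close>
  define G where "G = T1 f \<union> uminus ` T2 f"
  have "finite G" using finT by (auto simp: G_def)
  moreover have "full n G"
    unfolding full_def
  proof (intro allI impI)
    fix w j assume "\<forall>x\<in>G. ip n x w = 0" "j < n"
    then have "\<forall>x\<in>T1 f \<union> T2 f. ip n x w = 0" by (auto simp: G_def ball_Un ip_minus_left)
    then show "w j = 0" using fV(1) \<open>j < n\<close> unfolding V_def full_def by blast
  qed
  moreover have "ip n g (u - f) \<ge> 0" if "g \<in> G" for g
    using that uf by (auto simp: G_def T1_def T2_def ip_minus_left)
  ultimately obtain e where e: "\<And>g. g \<in> G \<Longrightarrow> ip n g e \<ge> 0" "ip n \<theta> e > 0"
     "full n (insert \<theta> {g\<in>G. ip n g e = 0})"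
    using extreme_ray[of G n "u - f" \<theta>] thuf by blast
  define C1 where "C1 = {x\<in>T1 f. ip n x e = 0}"
  define C2 where "C2 = {x\<in>T2 f. ip n x e = 0}"
  have fullC: "full n (insert \<theta> (C1 \<union> C2))"
    unfolding full_def
  proof (intro allI impI)
    fix w j assume *: "\<forall>x\<in>insert \<theta> (C1 \<union> C2). ip n x w = 0" "j < n"
    then have "\<forall>x\<in>insert \<theta> {g\<in>G. ip n g e = 0}. ip n x w = 0"
      by (auto simp: G_def ip_minus_left C1_def C2_def)
    then show "w j = 0" using e(3) \<open>j < n\<close> unfolding full_def by blast
  qed
  define X where "X = {x\<in>R. ip n x e \<noteq> 0}"
  \<comment> \<open>Ratio test: the step length at which \<open>x\<close> reaches 0 or its value in
    \<open>u\<close>.\<close>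
  define r where "r x = (if ip n x e < 0 then ip n x f / (- ip n x e) else ip n x (u - f) / ip n x e)" for x
  have X: "finite X" "X \<noteq> {}"
  proof -
    show "finite X" using fin by (auto simp: X_def)
    have "(\<Sum>x\<in>R. ip n x e) \<noteq> 0" using e(2) by (simp add: th)
    then show "X \<noteq> {}" unfolding X_def using sum.neutral[of R "\<lambda>x. ip n x e"] by blast
  qed
  have rpos: "r x > 0" if "x \<in> X" for x
  proof (cases "ip n x e < 0")
    case True
    then have "ip n x f \<noteq> 0" using e(1)[of x] that by (auto simp: G_def T1_def X_def)
    then have "ip n x f > 0" using uf[of x] that by (auto simp: X_def)
    then show ?thesis using True by (simp add: r_def divide_pos_neg)
  next
    case False
    then have pos: "ip n x e > 0" using that by (auto simp: X_def)
    have "ip n x (u - f) \<noteq> 0"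
      using e(1)[of "- x"] that pos by (auto simp: G_def T2_def X_def ip_minus_left)
    then have "ip n x (u - f) > 0" using uf[of x] that by (auto simp: X_def)
    then show ?thesis using pos by (simp add: r_def)
  qed
  define t where "t = Min (r ` X)"
  have "t \<in> r ` X" unfolding t_def using X by (intro Min_in) auto
  then obtain x0 where x0: "x0 \<in> X" "t = r x0" by blast
  have tle: "t \<le> r x" if "x \<in> X" for x unfolding t_def using X that by auto
  have tpos: "t > 0" using x0 rpos by simp
  define f' where "f' = (\<lambda>j. if j < n then (f + t *\<^sub>R e) j else 0)"
  have ipf': "ip n x f' = ip n x f + t * ip n x e" for x
  proof -
    have "ip n x f' = ip n x (f + t *\<^sub>R e)" by (rule ip_cong) (simp add: f'_def)
    then show ?thesis by (simp add: ip_simps)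
  qed
  have f'S: "f' \<in> S"
    unfolding S_def
  proof (intro CollectI ballI)
    fix x assume x: "x \<in> R"
    show "0 \<le> ip n x f' \<and> ip n x f' \<le> ip n x u"
    proof (cases "ip n x e" "0 :: real" rule: linorder_cases)
      case less
      then have "t \<le> ip n x f / (- ip n x e)" using tle[of x] x by (auto simp: X_def r_def)
      then have "t * (- ip n x e) \<le> ip n x f" using less by (subst (asm) pos_le_divide_eq) auto
      moreover have "t * ip n x e \<le> 0" using tpos less by (simp add: mult_pos_neg less_imp_le)
      ultimately show ?thesis using uf[OF x] unfolding ipf' by (auto simp: ip_simps)
    next
      case equal
      then show ?thesis using uf[OF x] by (auto simp: ipf' ip_simps)
    next
      case greater
      then have "t \<le> ip n x (u - f) / ip n x e" using tle[of x] x by (auto simp: X_def r_def)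
      then have "t * ip n x e \<le> ip n x (u - f)" using greater by (subst (asm) pos_le_divide_eq) auto
      moreover have "t * ip n x e \<ge> 0" using tpos greater by simp
      ultimately show ?thesis using uf[OF x] unfolding ipf' by (auto simp: ip_simps)
    qed
  qed
  have C1: "C1 \<subseteq> T1 f'" by (auto simp: C1_def T1_def ipf')
  have C2: "C2 \<subseteq> T2 f'" by (auto simp: C2_def T2_def ipf' ip_simps)
  have x0T: "x0 \<in> T1 f' \<union> T2 f'"
    using x0 by (auto simp: X_def r_def T1_def T2_def ipf' ip_simps field_simps)
  have "full n (T1 f' \<union> T2 f')"
    unfolding full_def
  proof (intro allI impI)
    fix w j assume *: "\<forall>x\<in>T1 f' \<union> T2 f'. ip n x w = 0" "j < n"
    \<comment> \<open>Up to this multiple of \<open>e\<close>, \<open>w\<close> is killed by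
      \<theta> and by the functionals tight along the edge, hence is 0; the newly tight
      \<open>x0\<close> does not vanish on \<open>e\<close> and forces \<open>c = 0\<close>.\<close>
    define c where "c = ip n \<theta> w / ip n \<theta> e"
    have "\<forall>x\<in>insert \<theta> (C1 \<union> C2). ip n x (w - c *\<^sub>R e) = 0"
      using * C1 C2 e(2) by (auto simp: ip_simps c_def C1_def C2_def)
    then have wc: "\<forall>j<n. (w - c *\<^sub>R e) j = 0" using fullC unfolding full_def by blast
    then have "ip n x0 w = ip n x0 (c *\<^sub>R e)" by (intro ip_cong) auto
    then have "c = 0" using * x0T x0 by (auto simp: ip_simps X_def)
    then show "w j = 0" using wc \<open>j < n\<close> by auto
  qed
  then have f'V: "f' \<in> V" using f'S by (auto simp: V_def f'_def)
  have "\<not> low f'"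
  proof
    assume "low f'"
    then have "ip n \<theta> f' \<le> ip n \<theta> f" using fmax f'V by (auto simp: L_def)
    then show False using tpos e(2) by (simp add: ipf' mult_le_0_iff)
  qed
  then have d1: "dim (T1 f') < n - k" using high f'V by blast
  have "n \<le> dim (insert \<theta> (C1 \<union> C2))"
    using fullC finT by (intro full_imp_dim_ge) (auto simp: C1_def C2_def)
  also have "\<dots> \<le> dim (C1 \<union> C2) + 1"
    using finT by (intro dim_insert_le) (auto simp: C1_def C2_def)
  finally have "n \<le> dim (C1 \<union> C2) + 1" .
  \<comment> \<open>A functional vanishing on \<open>u\<close> is tight in both senses along the
    whole edge. So the ranks of \<open>C1\<close> and \<open>C2\<close> add up to at least (n - 1) +
    (n - d), while the types at the two ends allow at most (n - k - 1) + (n - d + k - 1).\<close>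
  moreover have "dim (C1 \<union> C2) + dim {x\<in>R. ip n x u = 0} \<le> dim C1 + dim C2"
  proof (rule dim_submodular)
    have *: "x \<in> T1 f \<inter> T2 f \<and> ip n x e = 0" if "x \<in> R" "ip n x u = 0" for x
    proof -
      have "x \<in> T1 f \<inter> T2 f" using that uf[of x] by (auto simp: T1_def T2_def ip_simps)
      then show ?thesis using e(1)[of x] e(1)[of "- x"] by (auto simp: G_def ip_minus_left)
    qed
    show "{x\<in>R. ip n x u = 0} \<subseteq> C1" "{x\<in>R. ip n x u = 0} \<subseteq> C2"
      using * by (auto simp: C1_def C2_def)
  qed (use finT in \<open>auto simp: C1_def C2_def\<close>)
  moreover have "dim C1 \<le> dim (T1 f')"
    using finT C1 by (intro dim_mono_finite) (auto intro: span_base)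
  moreover have "dim C2 \<le> dim (T2 f)"
    using finT by (intro dim_mono_finite) (auto simp: C2_def intro: span_base)
  ultimately show False using d1 fV(2) dimu k unfolding low_def by linarith
qed

subsection \<open>The area of a symmetric convex polygon\<close>

definition det2 :: "real^2 \<Rightarrow> real^2 \<Rightarrow> real" where
  "det2 a b = vec_nth a 1 * vec_nth b 2 - vec_nth a 2 * vec_nth b 1"

text \<open>For \<open>det2 a b > 0\<close>, the open angle from \<open>a\<close> counterclockwise
  to \<open>b\<close>; open, so that adjacent sectors are disjoint.\<close>

definition sector :: "real^2 \<Rightarrow> real^2 \<Rightarrow> (real^2) set" where
  "sector a b = {v. det2 a v > 0 \<and> det2 v b > 0}"

lemma det2_simps [simp]:
  "det2 (a + b) c = det2 a c + det2 b c" "det2 a (b + c) = det2 a b + det2 a c"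
  "det2 (a - b) c = det2 a c - det2 b c" "det2 a (b - c) = det2 a b - det2 a c"
  "det2 (- a) c = - det2 a c" "det2 a (- c) = - det2 a c"
  "det2 (r *\<^sub>R a) c = r * det2 a c" "det2 a (r *\<^sub>R c) = r * det2 a c"
  "det2 a a = 0" "det2 a 0 = 0" "det2 0 a = 0"
  by (simp_all add: det2_def algebra_simps)

lemma det2_swap: "det2 a b = - det2 b a"
  by (simp add: det2_def)

lemma det2_Cramer: "det2 q z * det2 a b = det2 z b * det2 q a + det2 a z * det2 q b"
  by (simp add: det2_def algebra_simps)

lemma det2_vector: "det2 a v = inner (vector [- vec_nth a 2, vec_nth a 1]) v"
  by (simp add: det2_def inner_vec_def sum_2 algebra_simps)

lemma continuous_on_det2 [continuous_intros]:
  "continuous_on S f \<Longrightarrow> continuous_on S (\<lambda>x. det2 q (f x))"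
  unfolding det2_vector by (intro continuous_intros)

lemma negligible_det2: "a \<noteq> 0 \<or> c \<noteq> 0 \<Longrightarrow> negligible {v. det2 a v = c}"
proof -
  assume "a \<noteq> 0 \<or> c \<noteq> 0"
  then have "vector [- vec_nth a 2, vec_nth a 1] \<noteq> (0 :: real^2) \<or> c \<noteq> 0"
    by (auto simp: Finite_Cartesian_Product.vec_eq_iff forall_2)
  then show ?thesis unfolding det2_vector by (rule negligible_hyperplane)
qed

lemma convex_sector: "convex (sector a b)"
proof -
  have "sector a b = {v. inner (vector [- vec_nth a 2, vec_nth a 1]) v > 0} \<inter>
      {v. inner (vector [- vec_nth b 2, vec_nth b 1]) v < 0}"
    unfolding sector_def det2_vector[symmetric] using det2_swap[of _ b] by auto
  then show ?thesis by (auto intro: convex_Int convex_halfspace_gt convex_halfspace_lt)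
qed

text \<open>The open sector cuts off only parts of the two lines through 0, a null set. For
  collinear \<open>a\<close> and \<open>b\<close> it misses the triangle altogether, so the formula
  survives the degenerate case.\<close>

lemma measure_triangle_sector:
  assumes "det2 a b \<ge> 0"
  shows "measure lebesgue (convex hull {0, a, b} \<inter> sector a b) = det2 a b / 2"
proof (cases "det2 a b = 0")
  case True
  have "convex hull {0, a, b} \<inter> sector a b = {}"
  proof -
    have "det2 a (u *\<^sub>R a + v *\<^sub>R b) = 0" for u v using True by simp
    then show ?thesis by (auto simp: convex_hull_3_alt sector_def True)
  qed
  then show ?thesis using True by simp
next
  case False
  let ?T = "convex hull {0, a, b}"
  have nz: "a \<noteq> 0" "b \<noteq> 0" using False by auto
  have "?T - sector a b \<subseteq> {v. det2 a v = 0} \<union> {v. det2 b v = 0}"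
  proof
    fix v assume v: "v \<in> ?T - sector a b"
    then obtain s t where st: "v = s *\<^sub>R a + t *\<^sub>R b" "s \<ge> 0" "t \<ge> 0"
      by (auto simp: convex_hull_3_alt)
    have "det2 a v = t * det2 a b" "det2 v b = s * det2 a b" using st by auto
    moreover have "\<not> (det2 a v > 0 \<and> det2 v b > 0)" using v by (simp add: sector_def)
    ultimately have "det2 a v = 0 \<or> det2 v b = 0"
      using st assms by (metis less_eq_real_def mult_nonneg_nonneg)
    then show "v \<in> {v. det2 a v = 0} \<union> {v. det2 b v = 0}" using det2_swap[of v b] by auto
  qed
  moreover have "negligible ({v. det2 a v = 0} \<union> {v. det2 b v = 0})"
    using nz by (intro negligible_Un negligible_det2) auto
  ultimately have neg: "negligible (?T - sector a b)" by (rule negligible_subset[rotated])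
  have "measure lebesgue (?T \<inter> sector a b) = measure lebesgue ?T"
  proof (rule measure_negligible_symdiff)
    show "?T \<in> lmeasurable" by (intro measurable_convex bounded_convex_hull convex_convex_hull) auto
    have "?T - ?T \<inter> sector a b \<union> (?T \<inter> sector a b - ?T) = ?T - sector a b" by auto
    then show "negligible (?T - ?T \<inter> sector a b \<union> (?T \<inter> sector a b - ?T))" using neg by simp
  qed
  also have "\<dots> = measure lborel ?T"
  proof (rule measure_completion)
    show "?T \<in> sets lborel"
      using borel_compact[OF finite_imp_compact_convex_hull[of "{0, a, b}"]] by simp
  qed
  also have "\<dots> = det2 a b / 2"
    using content_triangle[of 0 a b] assms by (simp add: det2_def abs_if algebra_simps)
  finally show ?thesis .
qed

text \<open>The quadrilateral with vertices 0, \<open>a\<close>, \<open>z\<close>, \<open>b\<close>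
  is cut along \<open>z\<close> into two triangles inside \<open>K\<close>. The choice
  \<open>z = a\<close> is allowed and leaves the single triangle on \<open>a\<close> and
  \<open>b\<close>.\<close>

lemma measure_sector_ge:
  assumes K: "convex K" "bounded K" "0 \<in> K" "a \<in> K" "b \<in> K" "z \<in> K"
    and ab: "det2 a b > 0" and z: "det2 a z \<ge> 0" "det2 z b \<ge> 0"
  shows "measure lebesgue (K \<inter> sector a b) \<ge> (det2 a z + det2 z b) / 2"
proof -
  let ?A = "convex hull {0, a, z} \<inter> sector a z" and ?B = "convex hull {0, z, b} \<inter> sector z b"
  have sub: "?A \<union> ?B \<subseteq> K \<inter> sector a b"
  proof
    fix v assume v: "v \<in> ?A \<union> ?B"
    have "convex hull {0, a, z} \<subseteq> K" "convex hull {0, z, b} \<subseteq> K"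
      using K by (simp_all add: subset_hull)
    then have "v \<in> K" using v by blast
    moreover have "v \<in> sector a b"
    proof (cases "v \<in> ?A")
      case True
      then have *: "det2 a v > 0" "det2 v z > 0" by (auto simp: sector_def)
      \<comment> \<open>The three-term relation between 2x2 determinants transfers the sign
        conditions from the smaller sector to the larger one.\<close>
      have "det2 a z * det2 v b = det2 a v * det2 z b + det2 a b * det2 v z"
        by (simp add: det2_def algebra_simps)
      also have "\<dots> > 0" using * ab z by (intro add_nonneg_pos) auto
      finally show ?thesis using * z by (auto simp: sector_def zero_less_mult_iff)
    next
      case False
      then have *: "det2 z v > 0" "det2 v b > 0" using v by (auto simp: sector_def)
      have "det2 z b * det2 a v = det2 v b * det2 a z + det2 a b * det2 z v"
        by (simp add: det2_def algebra_simps)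
      also have "\<dots> > 0" using * ab z by (intro add_nonneg_pos) auto
      finally show ?thesis using * z by (auto simp: sector_def zero_less_mult_iff)
    qed
    ultimately show "v \<in> K \<inter> sector a b" by blast
  qed
  have meas: "?A \<in> lmeasurable" "?B \<in> lmeasurable"
    by (intro measurable_convex convex_Int convex_convex_hull convex_sector bounded_Int
        disjI1 bounded_convex_hull; simp)+
  have "\<not> (det2 v z > 0 \<and> det2 z v > 0)" for v using det2_swap[of z v] by simp
  then have "?A \<inter> ?B = {}" unfolding sector_def by blast
  then have "measure lebesgue (?A \<union> ?B) = measure lebesgue ?A + measure lebesgue ?B"
    using meas by (simp add: measure_Un3)
  also have "\<dots> = (det2 a z + det2 z b) / 2"
    by (simp add: measure_triangle_sector[OF z(1)] measure_triangle_sector[OF z(2)] add_divide_distrib)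
  finally have "(det2 a z + det2 z b) / 2 = measure lebesgue (?A \<union> ?B)" by simp
  also have "\<dots> \<le> measure lebesgue (K \<inter> sector a b)"
    by (intro measure_mono_fmeasurable sub sets.Un fmeasurableD meas measurable_convex convex_Int
        convex_sector K(1) bounded_Int disjI1 K(2))
  finally show ?thesis .
qed

text \<open>Vectors are paired by \<open>det2\<close> instead of an inner product. The determinant
  bound then says that \<open>Q\<close> is contained in the very polygon \<open>K\<close> that it
  defines, and this yields points of \<open>K\<close> for free.\<close>

locale unimodular_family =
  fixes Q :: "(real^2) set"
  assumes finQ: "finite Q" and det_le: "\<And>p q. p \<in> Q \<Longrightarrow> q \<in> Q \<Longrightarrow> \<bar>det2 p q\<bar> \<le> 1"
    and spanning: "\<exists>p\<in>Q. \<exists>q\<in>Q. det2 p q \<noteq> 0"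
begin

definition N :: "real^2 \<Rightarrow> real" where "N v = Max ((\<lambda>q. \<bar>det2 q v\<bar>) ` Q)"

lemma Q_nonempty: "Q \<noteq> {}"
  using spanning by blast

lemma N_le_iff: "N v \<le> r \<longleftrightarrow> (\<forall>q\<in>Q. \<bar>det2 q v\<bar> \<le> r)"
  unfolding N_def using finQ Q_nonempty by (subst Max_le_iff) auto

lemma N_attained: "\<exists>q\<in>Q. \<bar>det2 q v\<bar> = N v"
proof -
  have "N v \<in> (\<lambda>q. \<bar>det2 q v\<bar>) ` Q" unfolding N_def using finQ Q_nonempty by (intro Max_in) auto
  then show ?thesis by auto
qed

lemma N_scale: "N (r *\<^sub>R v) = \<bar>r\<bar> * N v"
proof -
  obtain q where q: "q \<in> Q" "\<bar>det2 q v\<bar> = N v" using N_attained by blast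
  have le: "\<bar>det2 p v\<bar> \<le> N v" if "p \<in> Q" for p using N_le_iff[of v "N v"] that by simp
  show ?thesis
  proof (rule antisym)
    show "N (r *\<^sub>R v) \<le> \<bar>r\<bar> * N v" using le by (auto simp: N_le_iff abs_mult mult_left_mono)
    show "\<bar>r\<bar> * N v \<le> N (r *\<^sub>R v)" using q N_le_iff[of "r *\<^sub>R v" "N (r *\<^sub>R v)"] by (auto simp: abs_mult)
  qed
qed

lemma N_minus: "N (- v) = N v"
  using N_scale[of "-1" v] by simp

lemma N_pos: "v \<noteq> 0 \<Longrightarrow> N v > 0"
proof (rule ccontr)
  assume v: "v \<noteq> 0" "\<not> N v > 0"
  obtain p q where pq: "p \<in> Q" "q \<in> Q" "det2 p q \<noteq> 0" using spanning by blast
  have "\<bar>det2 p v\<bar> \<le> N v" "\<bar>det2 q v\<bar> \<le> N v" using pq N_le_iff[of v "N v"] by auto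
  then have 0: "det2 p v = 0" "det2 q v = 0" using v by auto
  have "det2 p q *\<^sub>R v = det2 v q *\<^sub>R p + det2 p v *\<^sub>R q"
    by (simp add: Finite_Cartesian_Product.vec_eq_iff forall_2 det2_def algebra_simps)
  then show False using 0 pq v det2_swap[of v q] by simp
qed

lemma continuous_on_N: "continuous_on S f \<Longrightarrow> continuous_on S (\<lambda>x. N (f x))"
  unfolding N_def using finQ Q_nonempty
proof (induction Q rule: finite_ne_induct)
  case (singleton q)
  then show ?case by (auto intro!: continuous_intros)
next
  case (insert q P)
  have "(\<lambda>x. Max ((\<lambda>q. \<bar>det2 q (f x)\<bar>) ` insert q P)) =
      (\<lambda>x. max \<bar>det2 q (f x)\<bar> (Max ((\<lambda>q. \<bar>det2 q (f x)\<bar>) ` P)))"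
    using insert by simp
  then show ?case using insert by (auto intro!: continuous_intros)
qed

definition K :: "(real^2) set" where "K = {v. N v \<le> 1}"

lemma Q_subset_K: "Q \<subseteq> K"
  using det_le by (auto simp: K_def N_le_iff)

lemma convex_K: "convex K"
proof (rule convexI)
  fix x y and u v :: real assume xy: "x \<in> K" "y \<in> K" "0 \<le> u" "0 \<le> v" "u + v = 1"
  show "u *\<^sub>R x + v *\<^sub>R y \<in> K"
    unfolding K_def N_le_iff
  proof (intro CollectI ballI)
    fix q assume q: "q \<in> Q"
    have "\<bar>det2 q (u *\<^sub>R x + v *\<^sub>R y)\<bar> \<le> u * \<bar>det2 q x\<bar> + v * \<bar>det2 q y\<bar>"
      using xy abs_triangle_ineq[of "u * det2 q x" "v * det2 q y"] by (simp add: abs_mult)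
    also have "\<dots> \<le> u * 1 + v * 1"
      using xy q by (intro add_mono mult_left_mono) (auto simp: K_def N_le_iff)
    finally show "\<bar>det2 q (u *\<^sub>R x + v *\<^sub>R y)\<bar> \<le> 1" using xy by simp
  qed
qed

lemma bounded_K: "bounded K"
proof -
  obtain p q where pq: "p \<in> Q" "q \<in> Q" "det2 p q \<noteq> 0" using spanning by blast
  have "norm v \<le> (norm p + norm q) / \<bar>det2 p q\<bar>" if "v \<in> K" for v
  proof -
    have le: "\<bar>det2 v q\<bar> \<le> 1" "\<bar>det2 p v\<bar> \<le> 1"
      using that pq det2_swap[of v q] by (auto simp: K_def N_le_iff)
    have "\<bar>det2 p q\<bar> * norm v = norm (det2 p q *\<^sub>R v)" by simp
    also have "det2 p q *\<^sub>R v = det2 v q *\<^sub>R p + det2 p v *\<^sub>R q"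
      by (simp add: Finite_Cartesian_Product.vec_eq_iff forall_2 det2_def algebra_simps)
    also have "norm \<dots> \<le> \<bar>det2 v q\<bar> * norm p + \<bar>det2 p v\<bar> * norm q"
      using norm_triangle_ineq[of "det2 v q *\<^sub>R p" "det2 p v *\<^sub>R q"] by simp
    also have "\<dots> \<le> 1 * norm p + 1 * norm q" using le by (intro add_mono mult_right_mono) auto
    finally show ?thesis using pq by (simp add: field_simps)
  qed
  then show ?thesis unfolding bounded_iff by blast
qed

text \<open>If \<open>det2 a b\<close> is at least 1, the triangle suffices. Otherwise let
  \<open>z\<close> be a signed element of \<open>Q\<close> attaining the norm of
  \<open>b - a\<close>: the quadrilateral 0, \<open>a\<close>, \<open>z\<close>, \<open>b\<close>
  has area (det2 a z + det2 z b)/2 = det2 z (b - a)/2 = 1/2, provided \<open>z\<close> lies in the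
  angle between \<open>a\<close> and \<open>b\<close>.\<close>

lemma measure_K_sector_ge:
  assumes N: "N a = 1" "N b = 1" "N (b - a) = 1" and ab: "det2 a b > 0"
  shows "measure lebesgue (K \<inter> sector a b) \<ge> 1 / 2"
proof -
  have inK: "0 \<in> K" "a \<in> K" "b \<in> K" using N N_scale[of 0 0] by (auto simp: K_def)
  show ?thesis
  proof (cases "det2 a b \<ge> 1")
    case True
    then show ?thesis using measure_sector_ge[OF convex_K bounded_K inK inK(2) ab] ab by auto
  next
    case False
    have tight: "\<exists>q\<in>K. det2 q v = 1 \<and> (\<forall>w\<in>K. det2 q w \<le> 1)" if v: "N v = 1" for v
    proof -
      obtain q where q: "q \<in> Q" "\<bar>det2 q v\<bar> = 1" using N_attained[of v] v by auto
      have *: "\<bar>det2 q w\<bar> \<le> 1" if "w \<in> K" for w using that q by (auto simp: K_def N_le_iff)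
      show ?thesis
      proof (cases "det2 q v = 1")
        case True
        then show ?thesis using q * Q_subset_K by (intro bexI[of _ q]) (auto simp: abs_le_iff)
      next
        case False
        then have "det2 q v = - 1" using q by linarith
        moreover have "- q \<in> K" using q Q_subset_K N_minus[of q] by (auto simp: K_def)
        ultimately show ?thesis using * by (intro bexI[of _ "- q"]) (auto simp: abs_le_iff)
      qed
    qed
    obtain z where z: "z \<in> K" "det2 z (b - a) = 1" using tight[OF N(3)] by blast
    obtain qa where qa: "det2 qa a = 1" "\<And>w. w \<in> K \<Longrightarrow> det2 qa w \<le> 1" using tight[OF N(1)] by blast
    obtain qb where qb: "det2 qb b = 1" "\<And>w. w \<in> K \<Longrightarrow> det2 qb w \<le> 1" using tight[OF N(2)] by blast
    define s t where "s = det2 z b" and "t = det2 a z"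
    have st: "s + t = 1" using z det2_swap[of a z] by (simp add: s_def t_def)
    have le: "s * det2 q a + t * det2 q b \<le> det2 a b" if "det2 q z \<le> 1" for q
      using det2_Cramer[of q z a b] mult_right_mono[OF that, of "det2 a b"] ab
      by (simp add: s_def t_def)
    \<comment> \<open>If \<open>t\<close> were negative, the constraint \<open>qa\<close> tight at
      \<open>a\<close> would give at least s + t = 1 on the left of \<open>le\<close>, against
      \<open>det2 a b < 1\<close>. For \<open>s\<close> the argument is the same at
      \<open>b\<close>.\<close>
    have "t \<ge> 0"
    proof (rule ccontr)
      assume "\<not> t \<ge> 0"
      then have "t * det2 qa b \<ge> t" using qa(2)[OF inK(3)] by (simp add: mult_le_cancel_left1)
      then show False using le[of qa] qa z st False by simp
    qed
    moreover have "s \<ge> 0"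
    proof (rule ccontr)
      assume "\<not> s \<ge> 0"
      then have "s * det2 qb a \<ge> s" using qb(2)[OF inK(2)] by (simp add: mult_le_cancel_left1)
      then show False using le[of qb] qb z st False by simp
    qed
    ultimately show ?thesis
      using measure_sector_ge[OF convex_K bounded_K inK z(1) ab] st by (simp add: s_def t_def)
  qed
qed

text \<open>Walk along half of the unit circle of \<open>N\<close> from a point to its antipode: the
  distance from the start grows continuously from 0 to 2 and so takes the value 1. An angle strictly
  between 0 and pi gives the orientation.\<close>

lemma equilateral_exists: "\<exists>x y. N x = 1 \<and> N y = 1 \<and> N (y - x) = 1 \<and> det2 x y > 0"
proof -
  define v :: "real \<Rightarrow> real^2" where "v \<theta> = vector [cos \<theta>, sin \<theta>]" for \<theta>
  have v0: "v \<theta> \<noteq> 0" for \<theta>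
    using sin_zero_abs_cos_one[of \<theta>] by (auto simp: v_def Finite_Cartesian_Product.vec_eq_iff forall_2)
  have Npos: "N (v \<theta>) > 0" for \<theta> using N_pos v0 by blast
  define y where "y \<theta> = (1 / N (v \<theta>)) *\<^sub>R v \<theta>" for \<theta>
  have Ny: "N (y \<theta>) = 1" for \<theta> using Npos[of \<theta>] by (simp add: y_def N_scale)
  have cv: "continuous_on S v" for S
  proof -
    have "v = (\<lambda>\<theta>. cos \<theta> *\<^sub>R vector [1, 0] + sin \<theta> *\<^sub>R vector [0, 1])"
      by (auto simp: v_def Finite_Cartesian_Product.vec_eq_iff forall_2)
    then show ?thesis by (auto intro!: continuous_intros)
  qed
  have cy: "continuous_on S y" for S
    unfolding y_def using Npos by (intro continuous_intros continuous_on_N cv) (auto simp: less_imp_neq[symmetric])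
  define h where "h \<theta> = N (y \<theta> - y 0)" for \<theta>
  have ch: "continuous_on S h" for S
    unfolding h_def by (intro continuous_on_N continuous_intros cy)
  have vpi: "v pi = - v 0" by (simp add: v_def Finite_Cartesian_Product.vec_eq_iff forall_2)
  have "y pi = - y 0" unfolding y_def vpi N_minus by simp
  then have "y pi - y 0 = (-2) *\<^sub>R y 0" by (simp add: Finite_Cartesian_Product.vec_eq_iff)
  then have hpi: "h pi = 2" unfolding h_def by (simp only: N_scale Ny)
  have h0: "h 0 = 0" using N_scale[of 0 0] by (simp add: h_def)
  obtain \<theta> where \<theta>: "0 \<le> \<theta>" "\<theta> \<le> pi" "h \<theta> = 1"
    using IVT'[of h 0 1 pi] h0 hpi ch by auto
  then have "\<theta> \<noteq> 0" "\<theta> \<noteq> pi" using h0 hpi by auto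
  then have "sin \<theta> > 0" using \<theta> by (intro sin_gt_zero) auto
  then have "det2 (v 0) (v \<theta>) > 0" by (simp add: v_def det2_def)
  then have "det2 (y 0) (y \<theta>) > 0" using Npos by (simp add: y_def)
  then show ?thesis using \<theta> Ny by (auto simp: h_def)
qed

text \<open>An inscribed affinely regular hexagon $\pm x, \pm y, \pm (y - x)$ cuts the plane into six
  sectors, and each of them contributes area at least $1/2$: a constraint tight at a side's
  direction is, rotated, itself a point of $K$ lying beyond that side.\<close>

lemma measure_K_ge: "measure lebesgue K \<ge> 3"
proof -
  obtain x y where xy: "N x = 1" "N y = 1" "N (y - x) = 1" "det2 x y > 0"
    using equilateral_exists by blast
  define A where "A i = (if i = (0::nat) then x else if i = 1 then y else if i = 2 then y - x
    else if i = 3 then - x else if i = 4 then - y else x - y)" for i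
  define S where "S i = K \<inter> sector (A i) (A (Suc i mod 6))" for i
  have N': "N (x - y) = 1" using xy(3) N_minus[of "y - x"] by simp
  have six: "i \<in> {0,1,2,3,4,5}" if "i < 6" for i :: nat using that by auto
  have ge: "measure lebesgue (S i) \<ge> 1 / 2" if "i < 6" for i
  proof -
    consider "i = 0" | "i = 1" | "i = 2" | "i = 3" | "i = 4" | "i = 5" using six[OF \<open>i < 6\<close>] by blast
    then show ?thesis
      unfolding S_def
      by cases (rule measure_K_sector_ge; use xy N' N_minus[of x] N_minus[of y] det2_swap[of y x] in
        \<open>simp add: A_def\<close>)+
  qed
  have meas: "S i \<in> lmeasurable" for i
    unfolding S_def by (intro measurable_convex convex_Int convex_K convex_sector bounded_Int disjI1 bounded_K)
  \<comment> \<open>Up to the factor \<open>det2 x y\<close>, the arguments used below are the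
    coordinates of \<open>v\<close> in the basis \<open>x\<close>, \<open>y\<close>. Their signs
    determine the index of the sector, so disjointness follows without comparing pairs.\<close>
  define g where "g p r = (if p > 0 \<and> r > 0 then 0 else if p < 0 \<and> p + r > 0 then 1 else
      if r > 0 \<and> p + r < 0 then 2 else if p < 0 \<and> r < 0 then 3 else if p > 0 \<and> p + r < 0 then 4 else 5 :: nat)"
    for p r :: real
  have gS: "g (det2 v y) (det2 x v) = i" if "v \<in> S i" "i < 6" for i v
  proof -
    have sec: "v \<in> sector (A i) (A (Suc i mod 6))" using that by (simp add: S_def)
    consider "i = 0" | "i = 1" | "i = 2" | "i = 3" | "i = 4" | "i = 5" using six[OF \<open>i < 6\<close>] by blast
    then show ?thesis
      by cases (use sec det2_swap[of v x] det2_swap[of y v] in \<open>auto simp: g_def A_def sector_def\<close>)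
  qed
  have disj: "S i \<inter> S j = {}" if "i < 6" "j < 6" "i \<noteq> j" for i j
    using gS that by blast
  have "3 \<le> (\<Sum>i<6. measure lebesgue (S i))"
    using sum_mono[of "{..<6 :: nat}" "\<lambda>_. 1 / 2 :: real" "\<lambda>i. measure lebesgue (S i)"] ge by simp
  also have "\<dots> = measure lebesgue (\<Union>(S ` {..<6}))"
    using meas disj by (intro measure_negligible_finite_Union_image[symmetric]) (auto simp: pairwise_def)
  also have "\<dots> \<le> measure lebesgue K"
  proof (intro measure_mono_fmeasurable measurable_convex convex_K bounded_K)
    show "\<Union>(S ` {..<6}) \<subseteq> K" by (auto simp: S_def)
    show "\<Union>(S ` {..<6}) \<in> sets lebesgue" using meas by (intro sets.finite_UN fmeasurableD) auto
  qed
  finally show ?thesis .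
qed

text \<open>Halving \<open>K\<close> divides its area by 4, and the strict inequalities remove only
  finitely many lines. Strictness makes differences of two points of \<open>F\<close> satisfy bounds
  strictly below 1.\<close>

lemma measure_half_ge:
  defines "F \<equiv> {v. \<forall>q\<in>Q. \<bar>det2 q v\<bar> < 1 / 2}"
  shows "F \<in> lmeasurable" "bounded F" "measure lebesgue F \<ge> 3 / 4"
proof -
  let ?H = "(\<lambda>x. (1 / 2) *\<^sub>R x) ` K"
  have H: "v \<in> ?H \<longleftrightarrow> (\<forall>q\<in>Q. \<bar>det2 q v\<bar> \<le> 1 / 2)" for v
  proof
    assume "\<forall>q\<in>Q. \<bar>det2 q v\<bar> \<le> 1 / 2"
    then have "2 *\<^sub>R v \<in> K" by (auto simp: K_def N_le_iff abs_mult)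
    then show "v \<in> ?H" by (intro image_eqI[of _ _ "2 *\<^sub>R v"]) auto
  qed (auto simp: K_def N_le_iff abs_mult)
  have H': "?H \<in> lmeasurable"
    by (intro measurable_convex convex_scaling convex_K bounded_scaling bounded_K)
  have "measure lebesgue ?H = 1 / 4 * measure lebesgue K"
    using measure_lebesgue_affine[of "1 / 2" 0 K] by (simp add: power2_eq_square)
  then have mH: "measure lebesgue ?H \<ge> 3 / 4" using measure_K_ge by simp
  have "?H - F \<union> (F - ?H) \<subseteq> (\<Union>q\<in>Q. {v. det2 q v = 1 / 2} \<union> {v. det2 q v = - (1 / 2)})"
  proof
    fix v assume v: "v \<in> ?H - F \<union> (F - ?H)"
    then have "v \<in> ?H" "v \<notin> F" using H[of v] by (auto simp: F_def less_imp_le)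
    then obtain q where "q \<in> Q" "\<bar>det2 q v\<bar> = 1 / 2"
      unfolding H F_def by (auto simp: not_less intro: antisym)
    then have "q \<in> Q \<and> (det2 q v = 1 / 2 \<or> det2 q v = - (1 / 2))" by linarith
    then show "v \<in> (\<Union>q\<in>Q. {v. det2 q v = 1 / 2} \<union> {v. det2 q v = - (1 / 2)})" by blast
  qed
  moreover have "negligible ({v. det2 q v = 1 / 2} \<union> {v. det2 q v = - (1 / 2)})" for q
    by (intro negligible_Un negligible_det2) auto
  then have "negligible (\<Union>q\<in>Q. {v. det2 q v = 1 / 2} \<union> {v. det2 q v = - (1 / 2)})"
    using finQ by (intro negligible_Union) blast+
  ultimately have neg: "negligible (?H - F \<union> (F - ?H))" by (rule negligible_subset[rotated])
  show "F \<in> lmeasurable" using lmeasurable_negligible_symdiff[OF H' neg] .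
  show "measure lebesgue F \<ge> 3 / 4" using measure_negligible_symdiff[OF H' neg] mH by simp
  have "F \<subseteq> ?H" unfolding subset_iff H by (auto simp: F_def)
  then show "bounded F" using bounded_subset bounded_scaling[OF bounded_K] by blast
qed

end

subsection \<open>Packing translates in the plane\<close>

text \<open>Double counting: the sum of the indicators, integrated, is the left-hand side and is
  pointwise at most \<open>C\<close> times the indicator of \<open>U\<close>.\<close>

lemma sum_measure_le_multiplicity:
  assumes "finite J" "\<And>j. j \<in> J \<Longrightarrow> S j \<in> lmeasurable" "\<And>j. j \<in> J \<Longrightarrow> S j \<subseteq> U" "U \<in> lmeasurable"
    and mult: "\<And>y. card {j\<in>J. y \<in> S j} \<le> C"
  shows "(\<Sum>j\<in>J. measure lebesgue (S j)) \<le> real C * measure lebesgue U"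
proof -
  have int: "integrable lebesgue (indicator (S j) :: _ \<Rightarrow> real)" if "j \<in> J" for j
    using assms(2)[OF that] by (intro integrable_real_indicator) (auto simp: fmeasurable_def)
  have intU: "integrable lebesgue (indicator U :: _ \<Rightarrow> real)"
    using assms(4) by (intro integrable_real_indicator) (auto simp: fmeasurable_def)
  have "(\<Sum>j\<in>J. measure lebesgue (S j)) = (\<Sum>j\<in>J. integral\<^sup>L lebesgue (indicator (S j)))"
    using assms(2) by (intro sum.cong) auto
  also have "\<dots> = integral\<^sup>L lebesgue (\<lambda>y. \<Sum>j\<in>J. indicator (S j) y)"
    using int by (intro Bochner_Integration.integral_sum[symmetric]) auto
  also have "\<dots> \<le> integral\<^sup>L lebesgue (\<lambda>y. real C * indicator U y)"
  proof (intro integral_mono Bochner_Integration.integrable_sum integrable_mult_right int intU)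
    fix y
    have "(\<Sum>j\<in>J. indicator (S j) y) = real (card {j\<in>J. y \<in> S j})"
      using assms(1) by (simp add: indicator_def sum.If_cases Int_def)
    also have "\<dots> \<le> real C * indicator U y"
    proof (cases "y \<in> U")
      case True
      then show ?thesis using mult[of y] by simp
    next
      case False
      then have "{j\<in>J. y \<in> S j} = {}" using assms(3) by blast
      then show ?thesis by (simp only: card.empty) simp
    qed
    finally show "(\<Sum>j\<in>J. indicator (S j) y) \<le> real C * indicator U y" .
  qed
  also have "\<dots> = real C * measure lebesgue U" using assms(4) by simp
  finally show ?thesis .
qed

definition int_point :: "int \<times> int \<Rightarrow> real^2" where
  "int_point w = vector [of_int (fst w), of_int (snd w)]"

lemma int_point_nth [simp]: "vec_nth (int_point w) 1 = of_int (fst w)" "vec_nth (int_point w) 2 = of_int (snd w)"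
  by (simp_all add: int_point_def)

text \<open>Blichfeldt's argument: the translates \<open>c i + F\<close>, reduced modulo the integer
  lattice to a unit square, have total area \<open>card I\<close> times that of \<open>F\<close> but
  cover each point at most \<open>C\<close> times.\<close>

lemma packing_bound:
  fixes c :: "'i \<Rightarrow> real^2"
  assumes fin: "finite I" and F: "F \<in> lmeasurable" "bounded F"
    and mult: "\<And>y A. finite A \<Longrightarrow> (\<And>i w. (i, w) \<in> A \<Longrightarrow> i \<in> I \<and> y + int_point w - c i \<in> F) \<Longrightarrow> card A \<le> C"
  shows "real (card I) * measure lebesgue F \<le> real C"
proof -
  \<comment> \<open>Half-open, so that its integer translates tile the plane without
    overlap.\<close>
  define U :: "(real^2) set" where "U = {v. 0 \<le> vec_nth v 1 \<and> vec_nth v 1 < 1 \<and> 0 \<le> vec_nth v 2 \<and> vec_nth v 2 < 1}"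
  have Ucbox: "U \<subseteq> cbox 0 1" by (auto simp: U_def mem_box_cart forall_2)
  have "U = {v. vec_nth v 1 \<ge> 0} \<inter> {v. vec_nth v 1 < 1} \<inter> ({v. vec_nth v 2 \<ge> 0} \<inter> {v. vec_nth v 2 < 1})"
    by (auto simp: U_def)
  also have "\<dots> \<in> sets borel"
    by (intro sets.Int borel_closed borel_open closed_halfspace_component_ge_cart open_halfspace_component_lt_cart)
  finally have Umeas: "U \<in> lmeasurable"
    using bounded_subset[OF bounded_cbox Ucbox] by (intro bounded_set_imp_lmeasurable) auto
  have "measure lebesgue U \<le> measure lebesgue (cbox 0 (1 :: real^2))"
    using Ucbox Umeas by (intro measure_mono_fmeasurable) auto
  also have "\<dots> = 1" using content_cbox_cart[of 0 "1 :: real^2"] by (simp add: interval_ne_empty_cart)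
  finally have mU: "measure lebesgue U \<le> 1" .
  have "bounded (\<Union>i\<in>I. (\<lambda>x. c i + x) ` F)"
    by (intro bounded_UN ballI bounded_translation fin F)
  then obtain B where B: "\<And>i x. i \<in> I \<Longrightarrow> x \<in> F \<Longrightarrow> norm (c i + x) \<le> B"
    unfolding bounded_iff by auto
  \<comment> \<open>A finite window containing every cell that meets one of the translates, as all
    their points have norm at most \<open>B\<close>.\<close>
  define W where "W = {- \<lceil>B\<rceil> - 1 .. \<lceil>B\<rceil> + 1} \<times> {- \<lceil>B\<rceil> - 1 .. \<lceil>B\<rceil> + 1}"
  have finW: "finite W" by (simp add: W_def)
  define S where "S = (\<lambda>(i, w). (+) (c i - int_point w) ` F \<inter> U)"
  have Sm: "S j \<in> lmeasurable" for j
    unfolding S_def using F Umeas by (auto simp: split_beta intro!: fmeasurable.Int measurable_translation)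
  have part: "measure lebesgue F = (\<Sum>w\<in>W. measure lebesgue (S (i, w)))" if i: "i \<in> I" for i
  proof -
    define T where "T w = F \<inter> (+) (int_point w - c i) ` U" for w
    have mT: "measure lebesgue (S (i, w)) = measure lebesgue (T w)" for w
    proof -
      have tr: "x \<in> (+) a ` A \<longleftrightarrow> x - a \<in> A" for a x :: "real^2" and A
        by (auto intro: image_eqI[of x _ "x - a"])
      have "(+) a ` F \<inter> U = (+) a ` (F \<inter> (+) (- a) ` U)" for a
        unfolding set_eq_iff Int_iff tr by simp
      from this[of "c i - int_point w"] have "S (i, w) = (+) (c i - int_point w) ` T w"
        by (simp add: S_def T_def)
      then show ?thesis by (simp add: measure_translation)
    qed
    have "F = (\<Union>w\<in>W. T w)"
    proof
      show "(\<Union>w\<in>W. T w) \<subseteq> F" by (auto simp: T_def)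
      show "F \<subseteq> (\<Union>w\<in>W. T w)"
      proof
        fix x assume x: "x \<in> F"
        let ?p = "c i + x"
        define w where "w = (\<lfloor>vec_nth ?p 1\<rfloor>, \<lfloor>vec_nth ?p 2\<rfloor>)"
        have "\<bar>vec_nth ?p k\<bar> \<le> B" for k
          using component_le_norm_cart[of ?p k] B[OF i x] by linarith
        from this[of 1] this[of 2] have "w \<in> W"
          unfolding W_def w_def mem_Times_iff atLeastAtMost_iff fst_conv snd_conv by linarith
        moreover have "x \<in> T w"
          unfolding T_def
        proof (intro IntI image_eqI[of _ _ "?p - int_point w"])
          show "?p - int_point w \<in> U"
            unfolding U_def w_def mem_Collect_eq vector_minus_component int_point_nth fst_conv snd_conv by linarith
        qed (use x in auto)
        ultimately show "x \<in> (\<Union>w\<in>W. T w)" by blast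
      qed
    qed
    then have "measure lebesgue F = measure lebesgue (\<Union>(T ` W))" by simp
    also have "\<dots> = (\<Sum>w\<in>W. measure lebesgue (T w))"
    proof (rule measure_negligible_finite_Union_image[OF finW])
      show "T w \<in> lmeasurable" for w
        unfolding T_def using F Umeas by (intro fmeasurable.Int measurable_translation) auto
      have "T w \<inter> T w' = {}" if "w \<noteq> w'" for w w'
      proof -
        have False if xT: "x \<in> T w" "x \<in> T w'" for x
        proof -
          obtain p p' where p: "p \<in> U" "p' \<in> U" "x = int_point w - c i + p" "x = int_point w' - c i + p'"
            using xT unfolding T_def by blast
          then have "int_point w - int_point w' = p' - p" by (simp add: algebra_simps)
          then have "of_int (fst w - fst w') = vec_nth p' 1 - vec_nth p 1"
             "of_int (snd w - snd w') = vec_nth p' 2 - vec_nth p 2"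
            by (metis int_point_nth(1) of_int_diff vector_minus_component, metis int_point_nth(2) of_int_diff vector_minus_component)
          then have "\<bar>of_int (fst w - fst w') :: real\<bar> < 1" "\<bar>of_int (snd w - snd w') :: real\<bar> < 1"
            using p by (auto simp: U_def)
          then have "fst w = fst w'" "snd w = snd w'" by linarith+
          then show False using \<open>w \<noteq> w'\<close> by (simp add: prod_eq_iff)
        qed
        then show ?thesis by blast
      qed
      then show "pairwise (\<lambda>x y. negligible (T x \<inter> T y)) W" by (auto simp: pairwise_def)
    qed
    finally show ?thesis by (simp add: mT)
  qed
  have "real (card I) * measure lebesgue F = (\<Sum>i\<in>I. measure lebesgue F)" by simp
  also have "\<dots> = (\<Sum>i\<in>I. \<Sum>w\<in>W. measure lebesgue (S (i, w)))"
    by (intro sum.cong refl part)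
  also have "\<dots> = (\<Sum>j\<in>I \<times> W. measure lebesgue (S j))" by (simp add: sum.cartesian_product)
  also have "\<dots> \<le> real C * measure lebesgue U"
  proof (rule sum_measure_le_multiplicity)
    show "card {j \<in> I \<times> W. y \<in> S j} \<le> C" for y
    proof (rule mult)
      show "finite {j \<in> I \<times> W. y \<in> S j}" using fin finW by auto
      show "i \<in> I \<and> y + int_point w - c i \<in> F" if "(i, w) \<in> {j \<in> I \<times> W. y \<in> S j}" for i w
        using that by (auto simp: S_def)
    qed
  qed (use fin finW Sm Umeas in \<open>auto simp: S_def\<close>)
  also have "\<dots> \<le> real C" using mU by (simp add: mult_left_le)
  finally show ?thesis .
qed

subsection \<open>Incongruent integer vectors\<close>

text \<open>Euclid's algorithm on the top row by unimodular column operations; the sum of the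
  absolute values in that row decreases.\<close>

lemma column_reduction:
  fixes T :: "int mat"
  assumes "T \<in> carrier_mat n n" "n > 0"
  shows "\<exists>E\<in>carrier_mat n n. \<bar>det E\<bar> = 1 \<and> (\<forall>j. 0 < j \<and> j < n \<longrightarrow> (T * E) $$ (0, j) = 0)"
  using assms
proof (induction "\<Sum>j<n. nat \<bar>T $$ (0, j)\<bar>" arbitrary: T rule: less_induct)
  case less
  note T = less.prems(1)
  consider (two) j1 j2 where "j1 < n" "j2 < n" "j1 \<noteq> j2" "T $$ (0, j2) \<noteq> 0" "\<bar>T $$ (0, j2)\<bar> \<le> \<bar>T $$ (0, j1)\<bar>"
    | (zero) "\<forall>j. 0 < j \<and> j < n \<longrightarrow> T $$ (0, j) = 0"
    | (one) j1 where "0 < j1" "j1 < n" "\<forall>j<n. j \<noteq> j1 \<longrightarrow> T $$ (0, j) = 0"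
  proof (cases "\<forall>j. 0 < j \<and> j < n \<longrightarrow> T $$ (0, j) = 0")
    case True
    then show thesis using zero by blast
  next
    case False
    then obtain j1 where j1: "0 < j1" "j1 < n" "T $$ (0, j1) \<noteq> 0" by blast
    show thesis
    proof (cases "\<forall>j<n. j \<noteq> j1 \<longrightarrow> T $$ (0, j) = 0")
      case True
      then show thesis using one j1 by blast
    next
      case False
      then obtain j where j: "j < n" "j \<noteq> j1" "T $$ (0, j) \<noteq> 0" by blast
      then show thesis using two[of j j1] two[of j1 j] j1 by linarith
    qed
  qed
  then show ?case
  proof cases
    case zero
    then show ?thesis using T by (intro bexI[of _ "1\<^sub>m n"]) auto
  next
    case (one j1)
    define E where "E = (swaprows_mat n 0 j1 :: int mat)"
    have "T * E = swapcols 0 j1 T"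
      unfolding E_def using T one less.prems by (intro swapcols_mat[symmetric]) auto
    then have "(T * E) $$ (0, j) = 0" if "0 < j" "j < n" for j
      using T one that by auto
    moreover have "det E = - 1" unfolding E_def using one less.prems by (intro det_swaprows_mat) auto
    then have "\<bar>det E\<bar> = 1" by simp
    moreover have "E \<in> carrier_mat n n" by (simp add: E_def)
    ultimately show ?thesis by blast
  next
    case (two j1 j2)
    \<comment> \<open>This sign shortens the entry \<open>j1\<close> by exactly the absolute value
      of the entry \<open>j2\<close>.\<close>
    define c where "c = - (sgn (T $$ (0, j1)) * sgn (T $$ (0, j2)))"
    define E where "E = (addrow_mat n c j2 j1 :: int mat)"
    have E: "E \<in> carrier_mat n n" "det E = 1"
      using two by (auto simp: E_def det_addrow_mat)
    have TE: "T * E = addcol c j1 j2 T"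
      unfolding E_def using T two by (intro addcol_mat[symmetric]) auto
    have T': "T * E \<in> carrier_mat n n" using T E by simp
    have row: "(T * E) $$ (0, j) = (if j = j1 then c * T $$ (0, j2) + T $$ (0, j1) else T $$ (0, j))"
      if "j < n" for j using T that less.prems(2) unfolding TE by auto
    have "\<bar>c * T $$ (0, j2) + T $$ (0, j1)\<bar> < \<bar>T $$ (0, j1)\<bar>"
      using two by (auto simp: c_def sgn_if split: if_splits)
    then have "(\<Sum>j<n. nat \<bar>(T * E) $$ (0, j)\<bar>) < (\<Sum>j<n. nat \<bar>T $$ (0, j)\<bar>)"
      using two by (intro sum_strict_mono_ex1) (auto simp: row intro!: bexI[of _ j1])
    from less.hyps[OF this T' less.prems(2)]
    obtain F where F: "F \<in> carrier_mat n n" "\<bar>det F\<bar> = 1"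
      "\<forall>j. 0 < j \<and> j < n \<longrightarrow> (T * E * F) $$ (0, j) = 0" by blast
    have "E * F \<in> carrier_mat n n" using E F by simp
    moreover have "\<bar>det (E * F)\<bar> = 1" using det_mult[OF E(1) F(1)] E F by simp
    moreover have "T * (E * F) = T * E * F" using assoc_mult_mat[OF T E(1) F(1)] by simp
    ultimately show ?thesis using F(3) by (intro bexI[of _ "E * F"]) auto
  qed
qed

text \<open>The lattice generated by the columns of \<open>T\<close> has index |det T|. After column
  reduction the top row is (g, 0, ..., 0): the residues of the first coordinate split
  \<open>X\<close> into |g| classes, and each class, with its first coordinate cleared, is
  incongruent modulo the remaining block, whose determinant is smaller by the factor g.\<close>

lemma card_incongruent_le_det:
  fixes T :: "int mat"
  assumes "T \<in> carrier_mat n n" "det T \<noteq> 0" "finite X" "X \<subseteq> carrier_vec n"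
    and "\<And>x y z. x \<in> X \<Longrightarrow> y \<in> X \<Longrightarrow> z \<in> carrier_vec n \<Longrightarrow> x - y = T *\<^sub>v z \<Longrightarrow> x = y"
  shows "int (card X) \<le> \<bar>det T\<bar>"
  using assms
proof (induction n arbitrary: T X)
  case 0
  have "x = 0\<^sub>v 0" if "x \<in> X" for x
    using carrier_vecD[of x 0] 0(4) that vec_of_dim_0 by blast
  then have "card X \<le> card {0\<^sub>v 0 :: int vec}"
    by (intro card_mono) auto
  with 0(1) show ?case by simp
next
  case (Suc n)
  obtain E where E: "E \<in> carrier_mat (Suc n) (Suc n)" "\<bar>det E\<bar> = 1"
    and row0: "\<And>j. 0 < j \<Longrightarrow> j < Suc n \<Longrightarrow> (T * E) $$ (0, j) = 0"
    using column_reduction[OF Suc.prems(1)] by auto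
  define H where "H = T * E"
  have H: "H \<in> carrier_mat (Suc n) (Suc n)" using Suc.prems E by (simp add: H_def)
  have detH: "\<bar>det H\<bar> = \<bar>det T\<bar>"
    using det_mult[OF Suc.prems(1) E(1)] E(2) by (simp add: H_def abs_mult)
  have incong: "x = y" if "x \<in> X" "y \<in> X" "z \<in> carrier_vec (Suc n)" "x - y = H *\<^sub>v z" for x y z
  proof (rule Suc.prems(5)[OF that(1,2)])
    show "E *\<^sub>v z \<in> carrier_vec (Suc n)" using E that by simp
    show "x - y = T *\<^sub>v (E *\<^sub>v z)"
      using assoc_mult_mat_vec[OF Suc.prems(1) E(1) that(3)] that(4) by (simp add: H_def)
  qed
  define g where "g = H $$ (0, 0)"
  define H1 where "H1 = mat_delete H 0 0"
  have H1: "H1 \<in> carrier_mat n n" using H by (auto simp: H1_def intro: mat_delete_carrier)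
  have H1i: "H1 $$ (i, j) = H $$ (Suc i, Suc j)" if "i < n" "j < n" for i j
    using that H by (simp add: H1_def mat_delete_def)
  have "det H = (\<Sum>j<Suc n. H $$ (0, j) * cofactor H 0 j)"
    by (rule laplace_expansion_row[OF H]) simp
  also have "\<dots> = (\<Sum>j\<in>{0}. H $$ (0, j) * cofactor H 0 j)"
    using row0 by (intro sum.mono_neutral_right) (auto simp: H_def)
  finally have detH': "det H = g * det H1" by (simp add: g_def H1_def cofactor_def)
  then have g0: "g \<noteq> 0" "det H1 \<noteq> 0" using detH Suc.prems(2) by auto
  \<comment> \<open>Quotient by \<open>g\<close> with a nonnegative remainder, whatever the sign of
    \<open>g\<close>; \<phi> subtracts this multiple of the first column and forgets the first
    coordinate.\<close>
  define k where "k x = sgn g * (x $ 0 div \<bar>g\<bar>)" for x :: "int vec"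
  have kx: "x $ 0 = g * k x + x $ 0 mod \<bar>g\<bar>" for x
  proof -
    have "x $ 0 = \<bar>g\<bar> * (x $ 0 div \<bar>g\<bar>) + x $ 0 mod \<bar>g\<bar>" by simp
    also have "\<bar>g\<bar> * (x $ 0 div \<bar>g\<bar>) = g * k x"
      unfolding k_def mult.assoc[symmetric] by (simp add: sgn_if)
    finally show ?thesis .
  qed
  define \<phi> where "\<phi> x = vec n (\<lambda>i. x $ Suc i - k x * H $$ (Suc i, 0))" for x :: "int vec"
  define Y where "Y r = {x \<in> X. x $ 0 mod \<bar>g\<bar> = r}" for r
  have key: "x = y" if xy: "x \<in> Y r" "y \<in> Y r" and z: "z \<in> carrier_vec n" "\<phi> x - \<phi> y = H1 *\<^sub>v z" for x y z r
  proof (rule incong)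
    show "x \<in> X" "y \<in> X" using xy by (auto simp: Y_def)
    then have cx: "x \<in> carrier_vec (Suc n)" "y \<in> carrier_vec (Suc n)" using Suc.prems by auto
    define z' where "z' = vec (Suc n) (\<lambda>i. case i of 0 \<Rightarrow> k x - k y | Suc j \<Rightarrow> z $ j)"
    show "z' \<in> carrier_vec (Suc n)" by (simp add: z'_def)
    have Hz: "(H *\<^sub>v z') $ i = H $$ (i, 0) * (k x - k y) + (\<Sum>j<n. H $$ (i, Suc j) * z $ j)"
      if "i < Suc n" for i
    proof -
      have "(H *\<^sub>v z') $ i = (\<Sum>j<Suc n. H $$ (i, j) * z' $ j)"
        using H that by (simp add: scalar_prod_def z'_def atLeast0LessThan)
      also have "\<dots> = H $$ (i, 0) * z' $ 0 + (\<Sum>j<n. H $$ (i, Suc j) * z' $ Suc j)"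
        by (rule sum.lessThan_Suc_shift)
      finally show ?thesis by (simp add: z'_def)
    qed
    show "x - y = H *\<^sub>v z'"
    proof (rule eq_vecI)
      show "dim_vec (x - y) = dim_vec (H *\<^sub>v z')" using cx H by auto
      fix i assume "i < dim_vec (H *\<^sub>v z')"
      then have i: "i < Suc n" using H by simp
      show "(x - y) $ i = (H *\<^sub>v z') $ i"
      proof (cases i)
        case 0
        have "x $ 0 - y $ 0 = g * (k x - k y)"
          using kx[of x] kx[of y] xy by (simp add: Y_def algebra_simps)
        moreover have "(\<Sum>j<n. H $$ (0, Suc j) * z $ j) = 0"
          using row0 by (intro sum.neutral) (auto simp: H_def)
        ultimately show ?thesis using Hz[OF i] cx 0 by (simp add: g_def)
      next
        case (Suc i')
        then have i': "i' < n" using i by simp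
        have "(\<phi> x - \<phi> y) $ i' = (H1 *\<^sub>v z) $ i'" using z by simp
        also have "\<dots> = (\<Sum>j<n. H $$ (Suc i', Suc j) * z $ j)"
          using H1 z i' by (simp add: scalar_prod_def H1i atLeast0LessThan)
        finally show ?thesis using Hz[OF i] cx Suc i'
          by (simp add: \<phi>_def algebra_simps)
      qed
    qed
  qed
  have cardY: "int (card (Y r)) \<le> \<bar>det H1\<bar>" for r
  proof -
    have "inj_on \<phi> (Y r)"
    proof (rule inj_onI)
      fix x y assume xy: "x \<in> Y r" "y \<in> Y r" "\<phi> x = \<phi> y"
      have "H1 *\<^sub>v 0\<^sub>v n = 0\<^sub>v n" using H1 by auto
      moreover have "\<phi> x - \<phi> y = 0\<^sub>v n" using xy by (auto simp: \<phi>_def)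
      ultimately show "x = y" using key[OF xy(1,2), of "0\<^sub>v n"] by simp
    qed
    then have "card (Y r) = card (\<phi> ` Y r)" by (simp add: card_image)
    also have "int \<dots> \<le> \<bar>det H1\<bar>"
    proof (rule Suc.IH[OF H1 g0(2)])
      show "finite (\<phi> ` Y r)" using Suc.prems by (auto simp: Y_def)
      show "\<phi> ` Y r \<subseteq> carrier_vec n" by (auto simp: \<phi>_def)
      show "u = v" if "u \<in> \<phi> ` Y r" "v \<in> \<phi> ` Y r" "z \<in> carrier_vec n" "u - v = H1 *\<^sub>v z" for u v z
        using that key by blast
    qed
    finally show ?thesis .
  qed
  have "X = (\<Union>r\<in>{0..<\<bar>g\<bar>}. Y r)" using g0 by (auto simp: Y_def)
  then have "card X \<le> (\<Sum>r\<in>{0..<\<bar>g\<bar>}. card (Y r))"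
    by (metis card_UN_le finite_atLeastLessThan_int)
  then have "int (card X) \<le> (\<Sum>r\<in>{0..<\<bar>g\<bar>}. int (card (Y r)))"
    by (metis of_nat_le_iff of_nat_sum)
  also have "\<dots> \<le> (\<Sum>r\<in>{0..<\<bar>g\<bar>}. \<bar>det H1\<bar>)" by (intro sum_mono cardY)
  also have "\<dots> = \<bar>det T\<bar>" using detH' detH by (simp add: abs_mult)
  finally show ?case .
qed

subsection \<open>Determinants as functions of the rows\<close>

text \<open>With the rows given as a function, exchanging one of them is a function update; Cramer's
  rule and the Pluecker relation become identities between such updates.\<close>

definition rdet :: "nat \<Rightarrow> (nat \<Rightarrow> nat \<Rightarrow> 'a) \<Rightarrow> 'a :: comm_ring_1" where
  "rdet n \<rho> = det (mat n n (\<lambda>(i, j). \<rho> i j))"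

definition row_cofactor :: "nat \<Rightarrow> (nat \<Rightarrow> nat \<Rightarrow> 'a) \<Rightarrow> nat \<Rightarrow> nat \<Rightarrow> 'a :: comm_ring_1" where
  "row_cofactor n \<rho> i j = cofactor (mat n n (\<lambda>(i, j). \<rho> i j)) i j"

lemma rdet_upd_row:
  assumes "i < n"
  shows "rdet n (\<rho>(i := v)) = (\<Sum>j<n. v j * row_cofactor n \<rho> i j)"
proof -
  let ?M = "mat n n (\<lambda>(i', j). (\<rho>(i := v)) i' j)" and ?P = "mat n n (\<lambda>(i, j). \<rho> i j)"
  have "mat_delete ?M i j = mat_delete ?P i j" if "j < n" for j
    using assms that by (intro eq_matI) (auto simp: mat_delete_def)
  then have cof: "cofactor ?M i j = row_cofactor n \<rho> i j" if "j < n" for j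
    using that by (simp add: cofactor_def row_cofactor_def)
  have "rdet n (\<rho>(i := v)) = (\<Sum>j<n. ?M $$ (i, j) * cofactor ?M i j)"
    unfolding rdet_def by (rule laplace_expansion_row) (use assms in auto)
  also have "\<dots> = (\<Sum>j<n. v j * row_cofactor n \<rho> i j)"
    using assms cof by (intro sum.cong) auto
  finally show ?thesis .
qed

lemma rdet_identical_rows:
  assumes "i < n" "j < n" "i \<noteq> j" "\<rho> i = \<rho> j"
  shows "rdet n \<rho> = 0"
  unfolding rdet_def
  by (rule det_identical_rows[of _ n i j]) (use assms in auto)

lemma rdet_swap:
  fixes \<rho> :: "nat \<Rightarrow> nat \<Rightarrow> 'a :: comm_ring_1"
  assumes "i < n" "j < n" "i \<noteq> j"
  shows "rdet n (\<rho>(i := a, j := b)) = - rdet n (\<rho>(i := b, j := a))"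
proof -
  define p where "p = Transposition.transpose i j"
  have p: "p permutes {0..<n}" unfolding p_def using assms by (intro permutes_swap_id) auto
  let ?M = "mat n n (\<lambda>(k, l). (\<rho>(i := b, j := a)) k l)"
  have "mat n n (\<lambda>(k, l). (\<rho>(i := a, j := b)) k l) = mat n n (\<lambda>(k, l). ?M $$ (p k, l))"
    using assms by (intro eq_matI) (auto simp: p_def Transposition.transpose_def)
  then have "rdet n (\<rho>(i := a, j := b)) = det (mat n n (\<lambda>(k, l). ?M $$ (p k, l)))"
    by (simp only: rdet_def)
  also have "\<dots> = signof p * rdet n (\<rho>(i := b, j := a))"
    unfolding rdet_def by (rule det_permute_rows[OF _ p]) simp
  finally have "rdet n (\<rho>(i := a, j := b)) = signof p * rdet n (\<rho>(i := b, j := a))" .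
  moreover have "sign p = - 1" using assms by (simp add: p_def sign_swap_id)
  ultimately show ?thesis by simp
qed

text \<open>The adjugate identity read columnwise: a division-free expansion of \<open>x\<close> in
  the rows of \<rho>, valid over the integers and the reals alike.\<close>

lemma rdet_Cramer:
  fixes \<rho> :: "nat \<Rightarrow> nat \<Rightarrow> 'a :: comm_ring_1"
  assumes "j < n"
  shows "(\<Sum>i<n. rdet n (\<rho>(i := x)) * \<rho> i j) = rdet n \<rho> * x j"
proof -
  let ?M = "mat n n (\<lambda>(i, j). \<rho> i j)"
  have M: "?M \<in> carrier_mat n n" by simp
  have adj: "(\<Sum>i<n. row_cofactor n \<rho> i k * \<rho> i j) = (if k = j then rdet n \<rho> else 0)" if "k < n" for k
  proof -
    have "(\<Sum>i<n. row_cofactor n \<rho> i k * \<rho> i j) = (adj_mat ?M * ?M) $$ (k, j)"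
      using that assms adj_mat(1)[OF M]
      by (simp add: scalar_prod_def adj_mat_def row_cofactor_def atLeast0LessThan)
    also have "\<dots> = (if k = j then rdet n \<rho> else 0)"
      using that assms unfolding adj_mat(3)[OF M] by (simp add: rdet_def)
    finally show ?thesis .
  qed
  have "(\<Sum>i<n. rdet n (\<rho>(i := x)) * \<rho> i j) = (\<Sum>i<n. \<Sum>k<n. x k * (row_cofactor n \<rho> i k * \<rho> i j))"
    by (intro sum.cong) (auto simp: rdet_upd_row sum_distrib_right mult.assoc)
  also have "\<dots> = (\<Sum>k<n. x k * (\<Sum>i<n. row_cofactor n \<rho> i k * \<rho> i j))"
    by (subst sum.swap) (simp add: sum_distrib_left)
  also have "\<dots> = (\<Sum>k<n. if k = j then x k * rdet n \<rho> else 0)"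
    using adj by (intro sum.cong) auto
  also have "\<dots> = rdet n \<rho> * x j" using assms by (simp add: sum.delta mult.commute)
  finally show ?thesis .
qed

lemma rdet_Cramer_ip: "(\<Sum>i<n. rdet n (\<rho>(i := x)) * ip n (\<rho> i) q) = rdet n \<rho> * ip n x q"
proof -
  have "(\<Sum>i<n. rdet n (\<rho>(i := x)) * ip n (\<rho> i) q) = (\<Sum>j<n. (\<Sum>i<n. rdet n (\<rho>(i := x)) * \<rho> i j) * q j)"
    unfolding ip_def sum_distrib_left sum_distrib_right by (subst sum.swap) (simp add: mult.assoc)
  also have "\<dots> = (\<Sum>j<n. rdet n \<rho> * x j * q j)" by (intro sum.cong) (auto simp: rdet_Cramer)
  finally show ?thesis by (simp add: ip_def sum_distrib_left mult.assoc)
qed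

text \<open>Apply the linear functional \<open>L\<close>, the determinant as a function of row
  \<open>k\<close> with \<open>y\<close> in row \<open>l\<close>, to the Cramer expansion of
  \<open>x\<close>. Repeated rows kill every term except those for \<open>k\<close> and
  \<open>l\<close>.\<close>

lemma rdet_Plucker:
  fixes \<rho> :: "nat \<Rightarrow> nat \<Rightarrow> 'a :: comm_ring_1"
  assumes kl: "k < n" "l < n" "k \<noteq> l"
  shows "rdet n \<rho> * rdet n (\<rho>(k := x, l := y)) =
    rdet n (\<rho>(k := x)) * rdet n (\<rho>(l := y)) - rdet n (\<rho>(l := x)) * rdet n (\<rho>(k := y))"
proof -
  define L where "L v = rdet n (\<rho>(l := y, k := v))" for v
  have L: "L v = (\<Sum>j<n. v j * row_cofactor n (\<rho>(l := y)) k j)" for v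
    unfolding L_def using kl by (simp add: rdet_upd_row)
  have "rdet n \<rho> * L x = (\<Sum>j<n. (rdet n \<rho> * x j) * row_cofactor n (\<rho>(l := y)) k j)"
    by (simp add: L sum_distrib_left mult.assoc)
  also have "\<dots> = (\<Sum>j<n. (\<Sum>i<n. rdet n (\<rho>(i := x)) * \<rho> i j) * row_cofactor n (\<rho>(l := y)) k j)"
    by (intro sum.cong) (auto simp: rdet_Cramer)
  also have "\<dots> = (\<Sum>i<n. rdet n (\<rho>(i := x)) * L (\<rho> i))"
    unfolding L sum_distrib_left sum_distrib_right by (subst sum.swap) (simp add: mult.assoc)
  also have "\<dots> = (\<Sum>i\<in>{k, l}. rdet n (\<rho>(i := x)) * L (\<rho> i))"
  proof (rule sum.mono_neutral_right)
    have "L (\<rho> i) = 0" if "i \<in> {..<n} - {k, l}" for i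
      unfolding L_def using kl that by (intro rdet_identical_rows[of k n i]) auto
    then show "\<forall>i\<in>{..<n} - {k, l}. rdet n (\<rho>(i := x)) * L (\<rho> i) = 0" by simp
  qed (use kl in auto)
  also have "\<dots> = rdet n (\<rho>(k := x)) * L (\<rho> k) + rdet n (\<rho>(l := x)) * L (\<rho> l)"
    using kl by simp
  also have "L (\<rho> k) = rdet n (\<rho>(l := y))"
    unfolding L_def using kl by (metis fun_upd_other fun_upd_triv)
  also have "L (\<rho> l) = - rdet n (\<rho>(k := y))"
    unfolding L_def using rdet_swap[of l n k \<rho> y "\<rho> l"] kl by (simp add: fun_upd_triv)
  also have "L x = rdet n (\<rho>(k := x, l := y))"
    unfolding L_def by (simp only: fun_upd_twist[OF kl(3)[symmetric]])
  finally show ?thesis by (simp only: mult_minus_right diff_conv_add_uminus)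
qed

lemma rdet_nonzero:
  assumes "full n (\<rho> ` {..<n})"
  shows "rdet n \<rho> \<noteq> 0"
proof
  assume "rdet n \<rho> = 0"
  then obtain v where v: "v \<in> carrier_vec n" "v \<noteq> 0\<^sub>v n" "mat n n (\<lambda>(i, j). \<rho> i j) *\<^sub>v v = 0\<^sub>v n"
    unfolding rdet_def using det_0_iff_vec_prod_zero[of "mat n n (\<lambda>(i, j). \<rho> i j)" n] by auto
  have "ip n (\<rho> i) (\<lambda>j. v $ j) = 0" if "i < n" for i
  proof -
    have "(mat n n (\<lambda>(i, j). \<rho> i j) *\<^sub>v v) $ i = 0" using v that by simp
    then show ?thesis using that v(1) by (simp add: scalar_prod_def ip_def atLeast0LessThan)
  qed
  then have "\<forall>j<n. v $ j = 0" using assms unfolding full_def by blast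
  then have "v = 0\<^sub>v n" using v(1) by (intro eq_vecI) auto
  with v show False by simp
qed

definition rl :: "(nat \<Rightarrow> int) \<Rightarrow> nat \<Rightarrow> real" where
  "rl x = (\<lambda>j. real_of_int (x j))"

lemma rl_apply [simp]: "rl x j = real_of_int (x j)"
  by (simp add: rl_def)

lemma rdet_rl: "rdet n (\<lambda>i. rl (\<rho> i)) = real_of_int (rdet n \<rho>)"
proof -
  have "mat n n (\<lambda>(i, j). rl (\<rho> i) j) = map_mat real_of_int (mat n n (\<lambda>(i, j). \<rho> i j))"
    by (intro eq_matI) auto
  then show ?thesis by (simp add: rdet_def)
qed

lemma ip_rl: "ip n (rl x) (rl y) = real_of_int (\<Sum>j<n. x j * y j)"
  by (simp add: ip_def)

lemma rdet_rl_upd: "rdet n ((\<lambda>i. rl (\<rho> i))(i := rl a)) = real_of_int (rdet n (\<rho>(i := a)))"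
proof -
  have "(\<lambda>i. rl (\<rho> i))(i := rl a) = (\<lambda>k. rl ((\<rho>(i := a)) k))" by auto
  then show ?thesis by (simp only: rdet_rl)
qed

subsection \<open>The gap along a low-dimensional face\<close>

text \<open>\<alpha> is the functional whose value on \<open>f\<close> is to be bounded. It always
  occupies row 0, and \<open>minors\<close> concerns only determinants containing it.\<close>

locale bounded_minors =
  fixes n :: nat and RI :: "(nat \<Rightarrow> int) set" and \<alpha> :: "nat \<Rightarrow> int" and f :: "nat \<Rightarrow> real" and \<Delta> :: int
  assumes finRI: "finite RI" and fullRI: "full n (rl ` RI)"
    and supp: "\<And>x. x \<in> insert \<alpha> RI \<Longrightarrow> rl x \<in> supp_in n"
    and pos: "ip n (rl \<alpha>) f > 0"
    and minors: "\<And>\<rho>. \<rho> 0 = \<alpha> \<Longrightarrow> (\<And>i. 0 < i \<Longrightarrow> i < n \<Longrightarrow> \<rho> i \<in> RI) \<Longrightarrow> \<bar>rdet n \<rho>\<bar> \<le> \<Delta>"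
begin

text \<open>Since \<alpha> is positive on \<open>f\<close>, it lies outside the span of the rows
  vanishing on \<open>f\<close>. So \<alpha> and \<open>n - k\<close> independent rows of that kind
  extend to a basis: \<alpha> goes to position 0, the vanishing rows to the end, and positions 1 to
  \<open>k - 1\<close> remain free.\<close>

lemma basis_rows:
  assumes k: "0 < k" "k \<le> n" and dim: "dim {x \<in> rl ` RI. ip n x f = 0} \<ge> n - k"
  shows "\<exists>\<rho>. \<rho> 0 = \<alpha> \<and> (\<forall>i. 0 < i \<and> i < n \<longrightarrow> \<rho> i \<in> RI) \<and>
    (\<forall>i. k \<le> i \<and> i < n \<longrightarrow> ip n (rl (\<rho> i)) f = 0) \<and> rdet n \<rho> \<noteq> 0"
proof -
  let ?Z = "{x \<in> rl ` RI. ip n x f = 0}"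
  obtain C where C: "C \<subseteq> ?Z" "independent C" "?Z \<subseteq> span C" "card C = dim ?Z"
    using basis_exists by blast
  have "n - k \<le> card C" using C(4) dim by simp
  then obtain J where J: "J \<subseteq> C" "card J = n - k" "finite J"
    by (rule obtain_subset_with_card_n)
  have iJ: "independent J" using C J independent_mono by blast
  have notin: "rl \<alpha> \<notin> span J"
    using ip_eq_0_span[of "rl \<alpha>" J n f] C J pos by fastforce
  then have "independent (insert (rl \<alpha>) J)" using iJ by (rule independent_insertI)
  moreover have "insert (rl \<alpha>) J \<subseteq> insert (rl \<alpha>) (rl ` RI)" using C J by blast
  ultimately obtain B where B: "insert (rl \<alpha>) J \<subseteq> B" "B \<subseteq> insert (rl \<alpha>) (rl ` RI)"
     "independent B" "insert (rl \<alpha>) (rl ` RI) \<subseteq> span B"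
    using maximal_independent_subset_extend by metis
  have "B \<subseteq> supp_in n" using B(2) supp by blast
  from independent_card_le[OF B(3) this] have finB: "finite B" "card B \<le> n" by auto
  have fullB: "full n B"
    unfolding full_def
  proof (intro allI impI)
    fix w j assume w: "\<forall>x\<in>B. ip n x w = 0" "j < n"
    have "ip n x w = 0" if "x \<in> rl ` RI" for x
      using that B(4) w(1) by (intro ip_eq_0_span[of x B]) auto
    then show "w j = 0" using fullRI \<open>j < n\<close> unfolding full_def by blast
  qed
  have cardB: "card B = n"
    using full_imp_dim_ge[OF finB(1) fullB] dim_eq_card_independent[OF B(3)] finB(2) by simp
  let ?M = "B - insert (rl \<alpha>) J"
  have aJ: "rl \<alpha> \<notin> J" using notin span_base by blast
  have cM: "card ?M = k - 1"
    using cardB J aJ B(1) k by (subst card_Diff_subset) auto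
  obtain g1 where g1: "bij_betw g1 {1..<k} ?M"
    using finite_same_card_bij[of "{1..<k}" ?M] finB cM by auto
  obtain g2 where g2: "bij_betw g2 {k..<n} J"
    using finite_same_card_bij[of "{k..<n}" J] J by auto
  define h where "h i = (if i = 0 then rl \<alpha> else if i < k then g1 i else g2 i)" for i
  have him: "h ` {..<n} = B"
  proof -
    have split: "{..<n} = {0} \<union> {1..<k} \<union> {k..<n}" using k by auto
    have "h ` {1..<k} = ?M" using bij_betw_imp_surj_on[OF g1] by (auto simp: h_def image_iff)
    moreover have "h ` {k..<n} = J" using bij_betw_imp_surj_on[OF g2] k by (auto simp: h_def image_iff)
    ultimately show ?thesis unfolding split image_Un using B(1) by (auto simp: h_def)
  qed
  have h1: "h i \<in> ?M" if "0 < i" "i < k" for i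
    using bij_betwE[OF g1] that by (auto simp: h_def)
  have h2: "h i \<in> J" if "k \<le> i" "i < n" for i
    using bij_betwE[OF g2] that k by (auto simp: h_def)
  have hR: "h i \<in> rl ` RI" if "0 < i" "i < n" for i
  proof (cases "i < k")
    case True
    then show ?thesis using h1[of i] that B(2) by blast
  next
    case False
    then show ?thesis using h2[of i] that J C by auto
  qed
  define \<rho> where "\<rho> i = (if i = 0 then \<alpha> else inv_into RI rl (h i))" for i
  have rl\<rho>: "rl (\<rho> i) = h i" if "i < n" for i
    using hR[of i] that by (cases "i = 0") (auto simp: \<rho>_def h_def[of 0] f_inv_into_f)
  have "(\<lambda>i. rl (\<rho> i)) ` {..<n} = B" using him rl\<rho> by auto
  then have "rdet n (\<lambda>i. rl (\<rho> i)) \<noteq> 0" using fullB rdet_nonzero by metis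
  then have "rdet n \<rho> \<noteq> 0" by (simp add: rdet_rl)
  moreover have "\<rho> i \<in> RI" if "0 < i" "i < n" for i
    using hR[OF that] that by (auto simp: \<rho>_def inv_into_into)
  moreover have "ip n (rl (\<rho> i)) f = 0" if "k \<le> i" "i < n" for i
    using rl\<rho>[OF that(2)] h2[OF that] J C by auto
  moreover have "\<rho> 0 = \<alpha>" by (simp add: \<rho>_def)
  ultimately show ?thesis by blast
qed

lemma Delta_pos: "n > 0 \<Longrightarrow> \<Delta> > 0"
proof -
  assume "n > 0"
  then obtain \<rho> where \<rho>: "\<rho> 0 = \<alpha>" "\<And>i. 0 < i \<Longrightarrow> i < n \<Longrightarrow> \<rho> i \<in> RI" "rdet n \<rho> \<noteq> 0"
    using basis_rows[of n] by auto
  then show ?thesis using minors[of \<rho>, OF \<rho>(1,2)] by linarith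
qed

end

locale lattice_free_segment = bounded_minors +
  assumes lattice_free: "\<And>y q t. 0 \<le> t \<Longrightarrow> t \<le> 1 \<Longrightarrow> (\<And>x. x \<in> RI \<Longrightarrow> \<bar>ip n (rl x) q\<bar> < 1) \<Longrightarrow>
       (\<And>j. j < n \<Longrightarrow> rl y j = q j + t * f j) \<Longrightarrow> \<forall>j<n. y j = 0"
begin

text \<open>By Cramer's rule, the coefficient at row \<open>i\<close> when \<open>a\<close> is
  expanded in the rows of \<rho>.\<close>

definition co :: "(nat \<Rightarrow> nat \<Rightarrow> int) \<Rightarrow> nat \<Rightarrow> (nat \<Rightarrow> int) \<Rightarrow> real" where
  "co \<rho> i a = real_of_int (rdet n (\<rho>(i := a))) / real_of_int (rdet n \<rho>)"

text \<open>If the points were congruent modulo the rows' lattice, their difference would be an integer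
  vector of the form $q + t f$ excluded by the assumption. Such a vector lies in the span of the face
  of $f$, so $q$ is controlled by the rows $1, \ldots, k - 1$ through Cramer's rule.\<close>

lemma card_le_rdet:
  assumes D: "rdet n \<rho> \<noteq> 0" and \<rho>0: "\<rho> 0 = \<alpha>" and k: "0 < k" "k \<le> n"
    and tail: "\<And>i. k \<le> i \<Longrightarrow> i < n \<Longrightarrow> ip n (rl (\<rho> i)) f = 0"
    and X: "finite X" "\<And>x i. x \<in> X \<Longrightarrow> k \<le> i \<Longrightarrow> x i = 0"
      "\<And>x. x \<in> X \<Longrightarrow> 0 \<le> x 0 \<and> real_of_int (x 0) \<le> ip n (rl \<alpha>) f"
    and close: "\<And>x y a. x \<in> X \<Longrightarrow> y \<in> X \<Longrightarrow> a \<in> RI \<Longrightarrow>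
      \<bar>\<Sum>i\<in>{1..<k}. co \<rho> i a * (real_of_int (x i - y i) -
        real_of_int (x 0 - y 0) / ip n (rl \<alpha>) f * ip n (rl (\<rho> i)) f)\<bar> < 1"
  shows "int (card X) \<le> \<bar>rdet n \<rho>\<bar>"
proof -
  define T where "T = mat n n (\<lambda>(i, j). \<rho> i j)"
  have T: "T \<in> carrier_mat n n" by (simp add: T_def)
  have key: "x = y" if xy: "x \<in> X" "y \<in> X" "y 0 \<le> x 0"
    and z: "z \<in> carrier_vec n" "vec n x - vec n y = T *\<^sub>v z" for x y :: "nat \<Rightarrow> int" and z
  proof -
    define w where "w j = z $ j" for j
    \<comment> \<open>Makes \<open>q\<close> vanish on row 0; heights between 0 and \<alpha> f give
      \<open>t\<close> at most 1.\<close>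
    define t where "t = real_of_int (x 0 - y 0) / ip n (rl \<alpha>) f"
    define q where "q = rl w - t *\<^sub>R f"
    have t: "0 \<le> t" "t \<le> 1"
      using xy X(3)[of x] X(3)[of y] pos by (auto simp: t_def divide_le_eq)
    have ipw: "ip n (rl (\<rho> i)) (rl w) = real_of_int (x i - y i)" if "i < n" for i
    proof -
      have "(vec n x - vec n y) $ i = (T *\<^sub>v z) $ i" using z by simp
      then have "(\<Sum>j<n. \<rho> i j * w j) = x i - y i"
        using that z(1) by (simp add: T_def w_def scalar_prod_def atLeast0LessThan)
      then show ?thesis by (simp only: ip_rl)
    qed
    have ipq: "ip n (rl (\<rho> i)) q = real_of_int (x i - y i) - t * ip n (rl (\<rho> i)) f" if "i < n" for i
      using ipw[OF that] by (simp add: q_def ip_simps)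
    have "\<bar>ip n (rl a) q\<bar> < 1" if a: "a \<in> RI" for a
    proof -
      have "real_of_int (rdet n \<rho>) * ip n (rl a) q =
          (\<Sum>i<n. real_of_int (rdet n (\<rho>(i := a))) * ip n (rl (\<rho> i)) q)"
        using rdet_Cramer_ip[of n "\<lambda>i. rl (\<rho> i)" "rl a" q] by (simp only: rdet_rl rdet_rl_upd)
      also have "\<dots> = (\<Sum>i\<in>{1..<k}. real_of_int (rdet n (\<rho>(i := a))) * ip n (rl (\<rho> i)) q)"
      proof (rule sum.mono_neutral_right)
        have "ip n (rl (\<rho> i)) q = 0" if i: "i \<in> {..<n} - {1..<k}" for i
        proof (cases "i = 0")
          case True
          then show ?thesis using ipq[of 0] k pos \<rho>0 by (simp add: t_def)
        next
          case False
          then show ?thesis using ipq[of i] i X(2)[OF xy(1), of i] X(2)[OF xy(2), of i] tail[of i] by auto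
        qed
        then show "\<forall>i\<in>{..<n} - {1..<k}. real_of_int (rdet n (\<rho>(i := a))) * ip n (rl (\<rho> i)) q = 0"
          by simp
      qed (use k in auto)
      finally have "ip n (rl a) q =
          (\<Sum>i\<in>{1..<k}. real_of_int (rdet n (\<rho>(i := a))) * ip n (rl (\<rho> i)) q) / real_of_int (rdet n \<rho>)"
        using D by (simp add: nonzero_eq_divide_eq mult.commute)
      also have "\<dots> = (\<Sum>i\<in>{1..<k}. co \<rho> i a * ip n (rl (\<rho> i)) q)"
        by (simp add: co_def sum_divide_distrib)
      also have "\<dots> = (\<Sum>i\<in>{1..<k}. co \<rho> i a * (real_of_int (x i - y i) - t * ip n (rl (\<rho> i)) f))"
        using k ipq by (intro sum.cong) auto
      finally show ?thesis using close[OF xy(1,2) a] by (simp only: t_def)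
    qed
    then have "\<forall>j<n. w j = 0"
      using lattice_free[OF t, of q w] by (simp add: q_def)
    then have "\<forall>i<n. x i = y i" using ipw by (simp add: ip_def)
    moreover have "x i = 0" "y i = 0" if "n \<le> i" for i using X(2) xy k that by auto
    ultimately show "x = y" by (intro ext) (metis not_le)
  qed
  have "inj_on (vec n) X"
  proof (rule inj_onI)
    fix x y assume xy: "x \<in> X" "y \<in> X" "vec n x = vec n y"
    have "x i = y i" for i
    proof (cases "i < n")
      case True
      then show ?thesis using arg_cong[OF xy(3), of "\<lambda>v. v $ i"] by simp
    next
      case False
      then show ?thesis using X(2)[OF xy(1), of i] X(2)[OF xy(2), of i] k by simp
    qed
    then show "x = y" by blast
  qed
  then have "card X = card (vec n ` X)" by (simp add: card_image)
  also have "int \<dots> \<le> \<bar>det T\<bar>"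
  proof (rule card_incongruent_le_det[OF T])
    show "det T \<noteq> 0" using D by (simp add: T_def rdet_def)
    fix u v z assume uv: "u \<in> vec n ` X" "v \<in> vec n ` X" "z \<in> carrier_vec n" "u - v = T *\<^sub>v z"
    then obtain x y where xy: "x \<in> X" "y \<in> X" "u = vec n x" "v = vec n y" by blast
    show "u = v"
    \<comment> \<open>\<open>key\<close> takes the greater height first, to have \<open>t\<close>
      nonnegative; otherwise the two points are exchanged.\<close>
    proof (cases "y 0 \<le> x 0")
      case True
      then show ?thesis using key[of x y z] uv xy by simp
    next
      case False
      have "v - u = - (u - v)" using xy by (intro eq_vecI) auto
      also have "\<dots> = T *\<^sub>v (- z)"
        unfolding uv(4) using T uv(3) by (intro eq_vecI) (auto simp: scalar_prod_def sum_negf)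
      finally show ?thesis using key[of y x "- z"] uv xy False by simp
    qed
  qed (use X in auto)
  finally show ?thesis by (simp add: T_def rdet_def)
qed

text \<open>Row 1 is chosen with maximal determinant, so all coefficients
  \<open>co \<rho> 1 b\<close> lie in [-1, 1]. At each integer height \<open>h\<close> up to
  \<alpha> f take the least integer not below \<open>h * r\<close>. The rounding errors lie in [0,
  1) and differ by less than 1, so \<open>card_le_rdet\<close> applies to these \<open>M + 1\<close>
  points, and \<alpha> f is less than \<open>M + 1\<close>.\<close>

lemma gap_dim_2:
  assumes n: "2 \<le> n" and dim: "dim {x \<in> rl ` RI. ip n x f = 0} \<ge> n - 2"
  shows "ip n (rl \<alpha>) f < \<Delta>"
proof -
  obtain \<sigma> where \<sigma>: "\<sigma> 0 = \<alpha>" "\<And>i. 0 < i \<Longrightarrow> i < n \<Longrightarrow> \<sigma> i \<in> RI"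
    "\<And>i. 2 \<le> i \<Longrightarrow> i < n \<Longrightarrow> ip n (rl (\<sigma> i)) f = 0" "rdet n \<sigma> \<noteq> 0"
    using basis_rows[of 2] n dim by auto
  define V where "V = (\<lambda>a. \<bar>rdet n (\<sigma>(1 := a))\<bar>) ` RI"
  have V: "finite V" "\<bar>rdet n \<sigma>\<bar> \<in> V"
    using finRI \<sigma>(2)[of 1] n by (auto simp: V_def image_iff intro!: bexI[of _ "\<sigma> 1"])
  have "Max V \<in> V" using V by (intro Max_in) auto
  then obtain a where a: "a \<in> RI" "Max V = \<bar>rdet n (\<sigma>(1 := a))\<bar>" by (auto simp: V_def)
  define \<rho> where "\<rho> = \<sigma>(1 := a)"
  have max: "\<bar>rdet n (\<rho>(1 := b))\<bar> \<le> \<bar>rdet n \<rho>\<bar>" if "b \<in> RI" for b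
    using Max_ge[OF V(1), of "\<bar>rdet n (\<sigma>(1 := b))\<bar>"] that a by (auto simp: V_def \<rho>_def)
  have D: "rdet n \<rho> \<noteq> 0" using Max_ge[OF V] a \<sigma>(4) by (auto simp: \<rho>_def)
  have co: "\<bar>co \<rho> 1 b\<bar> \<le> 1" if "b \<in> RI" for b
    using max[OF that] D by (simp add: co_def divide_le_eq)
  have \<rho>: "\<rho> 0 = \<alpha>" "\<And>i. 0 < i \<Longrightarrow> i < n \<Longrightarrow> \<rho> i \<in> RI" "\<And>i. 2 \<le> i \<Longrightarrow> i < n \<Longrightarrow> ip n (rl (\<rho> i)) f = 0"
    using \<sigma> a by (auto simp: \<rho>_def)
  define r where "r = ip n (rl (\<rho> 1)) f / ip n (rl \<alpha>) f"
  define M where "M = \<lfloor>ip n (rl \<alpha>) f\<rfloor>"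
  define p where "p h = (\<lambda>i :: nat. if i = 0 then h else if i = 1 then \<lceil>real_of_int h * r\<rceil> else 0 :: int)" for h :: int
  have Mpos: "M \<ge> 0" using pos by (simp add: M_def)
  have "inj p" by (auto simp: inj_def p_def fun_eq_iff dest!: spec[of _ 0])
  then have "int (card (p ` {0..M})) = M + 1"
    using Mpos by (subst card_image) (auto intro: inj_on_subset)
  moreover have "int (card (p ` {0..M})) \<le> \<bar>rdet n \<rho>\<bar>"
  proof (rule card_le_rdet[OF D \<rho>(1), where k = 2])
    show "x i = 0" if "x \<in> p ` {0..M}" "2 \<le> i" for x i using that by (auto simp: p_def)
    show "0 \<le> x 0 \<and> real_of_int (x 0) \<le> ip n (rl \<alpha>) f" if "x \<in> p ` {0..M}" for x
      using that by (auto simp: p_def M_def le_floor_iff)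
    fix x y b assume xy: "x \<in> p ` {0..M}" "y \<in> p ` {0..M}" and b: "b \<in> RI"
    obtain h h' where h: "x = p h" "y = p h'" using xy by blast
    let ?d = "real_of_int (x 1 - y 1) - real_of_int (x 0 - y 0) / ip n (rl \<alpha>) f * ip n (rl (\<rho> 1)) f"
    have "?d = (real_of_int \<lceil>real_of_int h * r\<rceil> - real_of_int h * r) - (real_of_int \<lceil>real_of_int h' * r\<rceil> - real_of_int h' * r)"
      unfolding h by (simp add: p_def r_def algebra_simps diff_divide_distrib)
    then have "\<bar>?d\<bar> < 1" using ceiling_correct[of "real_of_int h * r"] ceiling_correct[of "real_of_int h' * r"] by linarith
    moreover have "\<bar>co \<rho> 1 b\<bar> * \<bar>?d\<bar> \<le> \<bar>?d\<bar>"
      using co[OF b] by (intro mult_left_le_one_le) auto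
    ultimately have "\<bar>co \<rho> 1 b * ?d\<bar> < 1" unfolding abs_mult by linarith
    moreover have "{1..<2} = {1 :: nat}" by auto
    ultimately show "\<bar>\<Sum>i\<in>{1..<2}. co \<rho> i b * (real_of_int (x i - y i) -
        real_of_int (x 0 - y 0) / ip n (rl \<alpha>) f * ip n (rl (\<rho> i)) f)\<bar> < 1" by simp
  qed (use n \<rho> in auto)
  ultimately have "M + 1 \<le> \<Delta>" using minors[of \<rho>, OF \<rho>(1,2)] by simp
  then show ?thesis unfolding M_def by linarith
qed

text \<open>Project the integer points $(h, w)$ with $0 \le h \le \alpha f$ along $f$ onto the plane
  $\alpha = 0$, in the coordinates given by two rows of maximal determinant $D$. Around these points
  put translates of the half-size copy of the polygon where all the rows are below $1$. A point of the
  plane lies in at most $D$ translates, while each height $h$ covers a proportion of at least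
  $3/4$.\<close>

lemma gap_dim_3:
  assumes n: "3 \<le> n" and dim: "dim {x \<in> rl ` RI. ip n x f = 0} \<ge> n - 3"
  shows "ip n (rl \<alpha>) f < 4 / 3 * \<Delta>"
proof -
  obtain \<sigma> where \<sigma>: "\<sigma> 0 = \<alpha>" "\<And>i. 0 < i \<Longrightarrow> i < n \<Longrightarrow> \<sigma> i \<in> RI"
    "\<And>i. 3 \<le> i \<Longrightarrow> i < n \<Longrightarrow> ip n (rl (\<sigma> i)) f = 0" "rdet n \<sigma> \<noteq> 0"
    using basis_rows[of 3] n dim by auto
  define V where "V = (\<lambda>(a, b). \<bar>rdet n (\<sigma>(1 := a, 2 := b))\<bar>) ` (RI \<times> RI)"
  have V: "finite V" "\<bar>rdet n \<sigma>\<bar> \<in> V"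
  proof -
    show "finite V" using finRI by (simp add: V_def)
    show "\<bar>rdet n \<sigma>\<bar> \<in> V"
      unfolding V_def using \<sigma>(2)[of 1] \<sigma>(2)[of 2] n by (intro image_eqI[of _ _ "(\<sigma> 1, \<sigma> 2)"]) auto
  qed
  have "Max V \<in> V" using V by (intro Max_in) auto
  then obtain a1 a2 where a: "a1 \<in> RI" "a2 \<in> RI" "Max V = \<bar>rdet n (\<sigma>(1 := a1, 2 := a2))\<bar>"
    by (auto simp: V_def)
  define \<rho> where "\<rho> = \<sigma>(1 := a1, 2 := a2)"
  have max: "\<bar>rdet n (\<rho>(1 := b, 2 := c))\<bar> \<le> \<bar>rdet n \<rho>\<bar>" if "b \<in> RI" "c \<in> RI" for b c
  proof -
    have "\<rho>(1 := b, 2 := c) = \<sigma>(1 := b, 2 := c)" by (auto simp: \<rho>_def)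
    moreover have "\<bar>rdet n (\<sigma>(1 := b, 2 := c))\<bar> \<in> V"
      unfolding V_def using that by (intro image_eqI[of _ _ "(b, c)"]) auto
    ultimately show ?thesis
      using Max_ge[OF V(1)] a(3) unfolding \<rho>_def by metis
  qed
  have D: "rdet n \<rho> \<noteq> 0" using Max_ge[OF V] a \<sigma>(4) by (auto simp: \<rho>_def)
  have \<rho>: "\<rho> 0 = \<alpha>" "\<And>i. 0 < i \<Longrightarrow> i < n \<Longrightarrow> \<rho> i \<in> RI" "\<And>i. 3 \<le> i \<Longrightarrow> i < n \<Longrightarrow> ip n (rl (\<rho> i)) f = 0"
    using \<sigma> a by (auto simp: \<rho>_def)
  \<comment> \<open>A quarter turn of the coefficient pair: \<open>det2 (qv b)\<close> is the linear
    form with coefficients \<open>co \<rho> 1 b\<close> and \<open>co \<rho> 2 b\<close>, and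
    determinants of two such pairs are unchanged.\<close>
  define qv :: "(nat \<Rightarrow> int) \<Rightarrow> real^2" where "qv b = vector [co \<rho> 2 b, - co \<rho> 1 b]" for b
  have det_qv: "det2 (qv b) v = co \<rho> 1 b * vec_nth v 1 + co \<rho> 2 b * vec_nth v 2" for b v
    by (simp add: det2_def qv_def)
  \<comment> \<open>Determinants of coefficient pairs become ratios of determinants of order
    \<open>n\<close>, which the maximal choice of rows 1 and 2 bounds by 1.\<close>
  have Plucker: "det2 (qv b) (qv c) = real_of_int (rdet n (\<rho>(1 := b, 2 := c))) / real_of_int (rdet n \<rho>)" for b c
  proof -
    have "real_of_int (rdet n \<rho>) * real_of_int (rdet n (\<rho>(1 := b, 2 := c))) =
       real_of_int (rdet n (\<rho>(1 := b))) * real_of_int (rdet n (\<rho>(2 := c))) -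
       real_of_int (rdet n (\<rho>(2 := b))) * real_of_int (rdet n (\<rho>(1 := c)))"
      using n unfolding of_int_mult[symmetric] of_int_diff[symmetric] of_int_eq_iff
      by (intro rdet_Plucker) auto
    moreover have "det2 (qv b) (qv c) =
       (real_of_int (rdet n (\<rho>(1 := b))) * real_of_int (rdet n (\<rho>(2 := c))) -
       real_of_int (rdet n (\<rho>(2 := b))) * real_of_int (rdet n (\<rho>(1 := c)))) /
       (real_of_int (rdet n \<rho>) * real_of_int (rdet n \<rho>))"
      unfolding det_qv by (simp add: qv_def co_def diff_divide_distrib)
    ultimately show ?thesis using D by (metis mult_divide_mult_cancel_left of_int_eq_0_iff)
  qed
  interpret unimodular_family "qv ` RI"
  proof
    show "finite (qv ` RI)" using finRI by simp
    show "\<bar>det2 p q\<bar> \<le> 1" if "p \<in> qv ` RI" "q \<in> qv ` RI" for p q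
    proof -
      obtain b c where bc: "b \<in> RI" "c \<in> RI" "p = qv b" "q = qv c" using \<open>p \<in> qv ` RI\<close> \<open>q \<in> qv ` RI\<close> by blast
      then show ?thesis using max[of b c] D by (simp add: Plucker divide_le_eq)
    qed
    have "det2 (qv (\<rho> 1)) (qv (\<rho> 2)) \<noteq> 0" using D by (simp add: Plucker)
    then show "\<exists>p\<in>qv ` RI. \<exists>q\<in>qv ` RI. det2 p q \<noteq> 0" using \<rho>(2)[of 1] \<rho>(2)[of 2] n by auto
  qed
  define F where "F = {v. \<forall>q\<in>qv ` RI. \<bar>det2 q v\<bar> < 1 / 2}"
  have F: "F \<in> lmeasurable" "bounded F" "measure lebesgue F \<ge> 3 / 4"
    unfolding F_def by (fact measure_half_ge)+
  define r where "r i = ip n (rl (\<rho> i)) f / ip n (rl \<alpha>) f" for i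
  define M where "M = nat \<lfloor>ip n (rl \<alpha>) f\<rfloor>"
  have M: "real m \<le> ip n (rl \<alpha>) f" if "m \<le> M" for m
    using that pos by (simp add: M_def nat_le_iff le_nat_iff le_floor_iff)
  \<comment> \<open>The values of rows 1 and 2 on the multiple of \<open>f\<close> at height
    \<open>h\<close>; subtracting them is the projection along \<open>f\<close>.\<close>
  define c :: "nat \<Rightarrow> real^2" where "c h = vector [real h * r 1, real h * r 2]" for h
  define p where "p = (\<lambda>(h, w). (\<lambda>i :: nat. if i = 0 then int h else if i = 1 then fst w else if i = 2 then snd w else 0 :: int))"
  have "inj p"
  proof (rule injI)
    fix s t assume "p s = p t"
    then have "p s 0 = p t 0" "p s 1 = p t 1" "p s 2 = p t 2" by simp_all
    then show "s = t" by (auto simp: p_def split_beta prod_eq_iff)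
  qed
  have "real (card {..M}) * measure lebesgue F \<le> real (nat \<bar>rdet n \<rho>\<bar>)"
  proof (rule packing_bound[of _ _ c])
    fix y A assume A: "finite A" "\<And>h w. (h, w) \<in> A \<Longrightarrow> h \<in> {..M} \<and> y + int_point w - c h \<in> F"
    have "int (card (p ` A)) \<le> \<bar>rdet n \<rho>\<bar>"
    proof (rule card_le_rdet[OF D \<rho>(1), where k = 3])
      show "x i = 0" if "x \<in> p ` A" "3 \<le> i" for x i using that by (auto simp: p_def)
      show "0 \<le> x 0 \<and> real_of_int (x 0) \<le> ip n (rl \<alpha>) f" if "x \<in> p ` A" for x
        using that A(2) M by (auto simp: p_def)
      fix x x' b assume xx: "x \<in> p ` A" "x' \<in> p ` A" and b: "b \<in> RI"
      obtain h w h' w' where hw: "(h, w) \<in> A" "x = p (h, w)" "(h', w') \<in> A" "x' = p (h', w')"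
        using xx by auto
      have "\<bar>det2 (qv b) (y + int_point w - c h)\<bar> < 1 / 2" "\<bar>det2 (qv b) (y + int_point w' - c h')\<bar> < 1 / 2"
        using A(2) hw b by (auto simp: F_def)
      \<comment> \<open>Two translates through the same point \<open>y\<close>: two values below 1/2
        differ by less than 1, and \<open>y\<close> cancels.\<close>
      then have "\<bar>det2 (qv b) (y + int_point w - c h) - det2 (qv b) (y + int_point w' - c h')\<bar> < 1" by linarith
      also have "det2 (qv b) (y + int_point w - c h) - det2 (qv b) (y + int_point w' - c h') =
        (\<Sum>i\<in>{1,2}. co \<rho> i b * (real_of_int (x i - x' i) -
        real_of_int (x 0 - x' 0) / ip n (rl \<alpha>) f * ip n (rl (\<rho> i)) f))"
        unfolding det_qv hw by (simp add: p_def c_def r_def algebra_simps diff_divide_distrib)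
      also have "{1, 2} = {1..<3 :: nat}" by auto
      finally show "\<bar>\<Sum>i\<in>{1..<3}. co \<rho> i b * (real_of_int (x i - x' i) -
        real_of_int (x 0 - x' 0) / ip n (rl \<alpha>) f * ip n (rl (\<rho> i)) f)\<bar> < 1" .
    qed (use n \<rho> A in auto)
    also have "card (p ` A) = card A" using \<open>inj p\<close> by (intro card_image) (auto intro: inj_on_subset)
    finally show "card A \<le> nat \<bar>rdet n \<rho>\<bar>" by simp
  qed (use F in auto)
  then have "real (M + 1) * (3 / 4) \<le> real_of_int \<bar>rdet n \<rho>\<bar>"
    using mult_left_mono[OF F(3), of "real (M + 1)"] by simp
  also have "\<dots> \<le> real_of_int \<Delta>" using minors[of \<rho>, OF \<rho>(1,2)] by simp
  finally have "real (M + 1) \<le> 4 / 3 * real_of_int \<Delta>" by simp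
  moreover have "ip n (rl \<alpha>) f < real (M + 1)" using pos unfolding M_def by linarith
  ultimately show ?thesis by linarith
qed

end

subsection \<open>The gap in general\<close>

text \<open>Split off faces of dimension $3$ (gap $4/3$), ending with one of dimension $3$ or with one or two
  of dimension $2$ (gap $1$); the worst remainder is $4 = 2 + 2$.\<close>

lemma gap_bound:
  fixes \<alpha> :: "nat \<Rightarrow> int" and \<Delta> :: int
  assumes finRI: "finite RI" and fullRI: "full n (rl ` RI)"
    and supp: "\<And>x. x \<in> insert \<alpha> RI \<Longrightarrow> rl x \<in> supp_in n"
    and lf: "\<And>f y q t. (\<And>x. x \<in> RI \<Longrightarrow> 0 \<le> ip n (rl x) f \<and> ip n (rl x) f \<le> ip n (rl x) u) \<Longrightarrow>
       0 \<le> t \<Longrightarrow> t \<le> 1 \<Longrightarrow> (\<And>x. x \<in> RI \<Longrightarrow> \<bar>ip n (rl x) q\<bar> < 1) \<Longrightarrow>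
       (\<And>j. j < n \<Longrightarrow> rl y j = q j + t * f j) \<Longrightarrow> \<forall>j<n. y j = 0"
    and minors: "\<And>\<rho>. \<rho> 0 = \<alpha> \<Longrightarrow> (\<And>i. 0 < i \<Longrightarrow> i < n \<Longrightarrow> \<rho> i \<in> RI) \<Longrightarrow> \<bar>rdet n \<rho>\<bar> \<le> \<Delta>"
    and Dpos: "\<Delta> > 0"
    and d: "2 \<le> d" "d \<le> n"
    and f: "\<And>x. x \<in> RI \<Longrightarrow> 0 \<le> ip n (rl x) f \<and> ip n (rl x) f \<le> ip n (rl x) u"
    and dimf: "dim {x \<in> rl ` RI. ip n x f = 0} \<ge> n - d"
  shows "ip n (rl \<alpha>) f < (4 * real d + 2) / 9 * real_of_int \<Delta>"
  using d f dimf
proof (induction d arbitrary: f rule: less_induct)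
  case (less d)
  have seg: "lattice_free_segment n RI \<alpha> g \<Delta>"
    if "\<And>x. x \<in> RI \<Longrightarrow> 0 \<le> ip n (rl x) g \<and> ip n (rl x) g \<le> ip n (rl x) u" "ip n (rl \<alpha>) g > 0" for g
  proof (intro lattice_free_segment.intro bounded_minors.intro lattice_free_segment_axioms.intro)
    show "rl x \<in> supp_in n" if "x \<in> insert \<alpha> RI" for x using supp that by blast
    show "\<bar>rdet n \<rho>\<bar> \<le> \<Delta>" if "\<rho> 0 = \<alpha>" "\<And>i. 0 < i \<Longrightarrow> i < n \<Longrightarrow> \<rho> i \<in> RI" for \<rho>
      using minors that by blast
    show "\<forall>j<n. y j = 0"
      if "0 \<le> t" "t \<le> 1" "\<And>x. x \<in> RI \<Longrightarrow> \<bar>ip n (rl x) q\<bar> < 1"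
        "\<And>j. j < n \<Longrightarrow> rl y j = q j + t * g j" for y q t
      by (rule lf[of g t q y]) (fact that \<open>\<And>x. x \<in> RI \<Longrightarrow> 0 \<le> ip n (rl x) g \<and> ip n (rl x) g \<le> ip n (rl x) u\<close>)+
  qed (fact finRI fullRI \<open>ip n (rl \<alpha>) g > 0\<close>)+
  have two: "ip n (rl \<alpha>) g < real_of_int \<Delta>"
    if "\<And>x. x \<in> RI \<Longrightarrow> 0 \<le> ip n (rl x) g \<and> ip n (rl x) g \<le> ip n (rl x) u"
      "dim {x \<in> rl ` RI. ip n x g = 0} \<ge> n - 2" for g
  proof (cases "ip n (rl \<alpha>) g > 0")
    case True
    then interpret lattice_free_segment n RI \<alpha> g \<Delta> using seg that(1) by blast
    show ?thesis using gap_dim_2 that(2) less.prems by simp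
  qed (use Dpos in simp)
  have three: "ip n (rl \<alpha>) g < 4 / 3 * real_of_int \<Delta>"
    if "\<And>x. x \<in> RI \<Longrightarrow> 0 \<le> ip n (rl x) g \<and> ip n (rl x) g \<le> ip n (rl x) u"
      "dim {x \<in> rl ` RI. ip n x g = 0} \<ge> n - 3" "3 \<le> n" for g
  proof (cases "ip n (rl \<alpha>) g > 0")
    case True
    then interpret lattice_free_segment n RI \<alpha> g \<Delta> using seg that(1) by blast
    show ?thesis using gap_dim_3 that(2,3) by simp
  qed (use Dpos in simp)
  have split: "\<exists>g. (\<forall>x\<in>RI. 0 \<le> ip n (rl x) g \<and> ip n (rl x) g \<le> ip n (rl x) u) \<and>
      (\<forall>x\<in>RI. 0 \<le> ip n (rl x) (f - g) \<and> ip n (rl x) (f - g) \<le> ip n (rl x) u) \<and>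
      dim {x \<in> rl ` RI. ip n x g = 0} \<ge> n - k \<and> dim {x \<in> rl ` RI. ip n x (f - g) = 0} \<ge> n - (d - k)"
    if "k \<le> d" for k
  proof -
    have "\<exists>g. (\<forall>x\<in>rl ` RI. 0 \<le> ip n x g \<and> ip n x g \<le> ip n x f) \<and>
        dim {x \<in> rl ` RI. ip n x g = 0} \<ge> n - k \<and> dim {x \<in> rl ` RI. ip n x (f - g) = 0} \<ge> n - (d - k)"
    proof (rule cone_splitting)
      show "0 \<le> ip n x f" if "x \<in> rl ` RI" for x using less.prems(3) that by blast
    qed (fact finite_imageI[OF finRI] fullRI less.prems that)+
    then obtain g where g: "\<And>x. x \<in> rl ` RI \<Longrightarrow> 0 \<le> ip n x g \<and> ip n x g \<le> ip n x f"
      "dim {x \<in> rl ` RI. ip n x g = 0} \<ge> n - k" "dim {x \<in> rl ` RI. ip n x (f - g) = 0} \<ge> n - (d - k)"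
      by blast
    have "0 \<le> ip n (rl x) g \<and> ip n (rl x) g \<le> ip n (rl x) u"
      "0 \<le> ip n (rl x) (f - g) \<and> ip n (rl x) (f - g) \<le> ip n (rl x) u" if "x \<in> RI" for x
      using g(1)[OF imageI[OF that]] less.prems(3)[OF that] unfolding ip_diff_right by linarith+
    then show ?thesis using g(2,3) by blast
  qed
  have sum: "ip n (rl \<alpha>) f = ip n (rl \<alpha>) g + ip n (rl \<alpha>) (f - g)" for g
    by (simp add: ip_diff_right)
  consider "d = 2" | "d = 3" | "d = 4" | "d \<ge> 5" using less.prems(1) by linarith
  then show ?case
  proof cases
    case 1
    then have "ip n (rl \<alpha>) f < real_of_int \<Delta>" using two less.prems by blast
    then show ?thesis using 1 Dpos by (simp del: rl_apply)
  next
    case 2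
    then have "ip n (rl \<alpha>) f < 4 / 3 * real_of_int \<Delta>" using three less.prems by blast
    then show ?thesis using 2 Dpos by (simp del: rl_apply)
  next
    case 3
    obtain g where g: "\<And>x. x \<in> RI \<Longrightarrow> 0 \<le> ip n (rl x) g \<and> ip n (rl x) g \<le> ip n (rl x) u"
      "\<And>x. x \<in> RI \<Longrightarrow> 0 \<le> ip n (rl x) (f - g) \<and> ip n (rl x) (f - g) \<le> ip n (rl x) u"
      "dim {x \<in> rl ` RI. ip n x g = 0} \<ge> n - 2" "dim {x \<in> rl ` RI. ip n x (f - g) = 0} \<ge> n - (d - 2)"
      using split[of 2] 3 by auto
    have "d - 2 = 2" using 3 by simp
    then have "ip n (rl \<alpha>) g < real_of_int \<Delta>" "ip n (rl \<alpha>) (f - g) < real_of_int \<Delta>"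
      using two[OF g(1,3)] two[OF g(2)] g(4) by simp_all
    then show ?thesis using 3 sum[of g] by (simp del: rl_apply)
  next
    case 4
    obtain g where g: "\<And>x. x \<in> RI \<Longrightarrow> 0 \<le> ip n (rl x) g \<and> ip n (rl x) g \<le> ip n (rl x) u"
      "\<And>x. x \<in> RI \<Longrightarrow> 0 \<le> ip n (rl x) (f - g) \<and> ip n (rl x) (f - g) \<le> ip n (rl x) u"
      "dim {x \<in> rl ` RI. ip n x g = 0} \<ge> n - 3" "dim {x \<in> rl ` RI. ip n x (f - g) = 0} \<ge> n - (d - 3)"
      using split[of 3] 4 by auto
    have "ip n (rl \<alpha>) g < 4 / 3 * real_of_int \<Delta>" using three[OF g(1,3)] 4 less.prems by simp
    moreover have "ip n (rl \<alpha>) (f - g) < (4 * real (d - 3) + 2) / 9 * real_of_int \<Delta>"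
    proof (rule less.IH)
      \<comment> \<open>Here d at least 5 matters: from 4, removing 3 would leave dimension 1,
        outside the induction.\<close>
      show "d - 3 < d" "2 \<le> d - 3" "d - 3 \<le> n" using 4 less.prems by simp_all
    qed (fact g)+
    \<comment> \<open>4/3 is exactly the growth of (4 d + 2)/9 over three dimensions.\<close>
    ultimately show ?thesis using 4 sum[of g] by (simp add: of_nat_diff field_simps del: rl_apply)
  qed
qed

subsection \<open>Bounding the determinants by $\Delta_{n-1}$\<close>

lemma Delta_ge:
  assumes "I \<subseteq> {..<dim_row A}" "J \<subseteq> {..<dim_col A}" "card I = k" "card J = k"
  shows "\<bar>det (submatrix A I J)\<bar> \<le> Delta k A"
  unfolding Delta_def
proof (rule Max_ge)
  let ?S = "{\<bar>det (submatrix A I J)\<bar> | I J. I \<subseteq> {..<dim_row A} \<and> J \<subseteq> {..<dim_col A} \<and> card I = k \<and> card J = k}"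
  have "?S \<subseteq> (\<lambda>(I, J). \<bar>det (submatrix A I J)\<bar>) ` (Pow {..<dim_row A} \<times> Pow {..<dim_col A})" by auto
  then show "finite ?S" by (rule finite_subset) auto
qed (use assms in blast)

lemma Delta_nonneg:
  assumes "k \<le> dim_row A" "k \<le> dim_col A"
  shows "Delta k A \<ge> 0"
  using Delta_ge[of "{..<k}" A "{..<k}" k] assms by fastforce

text \<open>\<open>Delta\<close> sees rows only as sets in increasing order. A repeated row makes
  the determinant 0; distinct rows are sorted by the permutation \<open>p\<close>, which changes
  only the sign.\<close>

lemma abs_det_rows_le_Delta:
  fixes A :: "int mat"
  assumes A: "A \<in> carrier_mat m n" and J: "J \<subseteq> {..<n}" "card J = k" and \<tau>: "\<And>i. i < k \<Longrightarrow> \<tau> i < m" and "k \<le> m"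
  shows "\<bar>det (mat k k (\<lambda>(i, j). A $$ (\<tau> i, pick J j)))\<bar> \<le> Delta k A"
proof (cases "inj_on \<tau> {..<k}")
  case False
  then obtain i i' where ii: "i < k" "i' < k" "i \<noteq> i'" "\<tau> i = \<tau> i'" by (auto simp: inj_on_def)
  have "det (mat k k (\<lambda>(i, j). A $$ (\<tau> i, pick J j))) = 0"
    by (rule det_identical_rows[of _ k i i']) (use ii in auto)
  moreover have "k \<le> n" using J card_mono[of "{..<n}" J] by simp
  ultimately show ?thesis using Delta_nonneg[of k A] A \<open>k \<le> m\<close> by simp
next
  case True
  define I where "I = \<tau> ` {..<k}"
  have I: "I \<subseteq> {..<m}" "card I = k" using \<tau> True by (auto simp: I_def card_image)
  then have finI: "finite I" using finite_subset by blast
  define p where "p i = (if i < k then card {a\<in>I. a < \<tau> i} else i)" for i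
  have pick: "pick I (p i) = \<tau> i" if "i < k" for i
    using that pick_card_in_set[of "\<tau> i" I] by (simp add: p_def I_def)
  have "p i < k" if "i < k" for i
  proof -
    have "{a\<in>I. a < \<tau> i} \<subset> I" using that by (auto simp: I_def)
    then show ?thesis using psubset_card_mono[OF finI] I that by (simp add: p_def)
  qed
  moreover have "inj_on p {0..<k}"
    using pick True by (auto simp: inj_on_def) (metis lessThan_iff)
  moreover from calculation(1) have "p ` {0..<k} \<subseteq> {0..<k}" by auto
  ultimately have "bij_betw p {0..<k} {0..<k}"
    using endo_inj_surj[of "{0..<k}" p] by (simp add: bij_betw_def)
  then have p: "p permutes {0..<k}" by (rule bij_imp_permutes) (simp add: p_def)
  have "{i. i < dim_row A \<and> i \<in> I} = I" "{j. j < dim_col A \<and> j \<in> J} = J" using A I J by auto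
  then have sub: "submatrix A I J = mat k k (\<lambda>(i, j). A $$ (pick I i, pick J j))"
    using I J by (simp add: submatrix_def)
  have "det (mat k k (\<lambda>(i, j). A $$ (\<tau> i, pick J j))) = det (mat k k (\<lambda>(i, j). submatrix A I J $$ (p i, j)))"
    using pick \<open>\<And>i. i < k \<Longrightarrow> p i < k\<close> sub by (intro arg_cong[of _ _ det] eq_matI) auto
  also have "\<dots> = signof p * det (submatrix A I J)"
    by (rule det_permute_rows[OF _ p]) (simp add: sub)
  finally have "\<bar>det (mat k k (\<lambda>(i, j). A $$ (\<tau> i, pick J j)))\<bar> = \<bar>det (submatrix A I J)\<bar>"
    by (simp add: abs_mult sign_def)
  then show ?thesis using Delta_ge[of I A J k] A I J by simp
qed

lemma det_scale_rows:
  "det (mat k k (\<lambda>(i, j). s i * B i j)) = (\<Prod>i<k. s i) * det (mat k k (\<lambda>(i, j). B i j :: 'a :: comm_ring_1))"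
proof -
  have "(\<Prod>i = 0..<k. mat k k (\<lambda>(i, j). s i * B i j) $$ (i, p i)) =
      (\<Prod>i<k. s i) * (\<Prod>i = 0..<k. mat k k (\<lambda>(i, j). B i j) $$ (i, p i))" if "p permutes {0..<k}" for p
  proof -
    have "p i < k" if "i < k" for i using \<open>p permutes {0..<k}\<close> that permutes_in_image[of p "{0..<k}" i] by simp
    then show ?thesis by (simp add: prod.distrib atLeast0LessThan)
  qed
  then show ?thesis
    unfolding det_def'[of _ k, OF mat_carrier] sum_distrib_left
    by (intro sum.cong) (auto simp: mult.left_commute)
qed

text \<open>Laplace expansion along row 0, a signed unit vector, deletes column \<open>l\<close>;
  the signs of the remaining rows of \<open>A\<close> factor out.\<close>

lemma abs_rdet_le_Delta:
  fixes A :: "int mat"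
  assumes A: "A \<in> carrier_mat m n" and l: "l < n" and m: "n - 1 \<le> m" and s: "\<bar>s\<bar> = 1"
    and \<rho>0: "\<rho> 0 = (\<lambda>j. if j = l then s else 0)"
    and \<rho>: "\<And>i. 0 < i \<Longrightarrow> i < n \<Longrightarrow> \<exists>k<m. \<exists>t. \<bar>t\<bar> = 1 \<and> \<rho> i = (\<lambda>j. if j < n then t * A $$ (k, j) else 0)"
  shows "\<bar>rdet n \<rho>\<bar> \<le> Delta (n - 1) A"
proof -
  let ?M = "mat n n (\<lambda>(i, j). \<rho> i j)"
  define J where "J = {..<n} - {l}"
  have J: "J \<subseteq> {..<n}" "card J = n - 1" using l by (auto simp: J_def)
  have pickJ: "pick J j = (if j < l then j else Suc j)" if j: "j < n - 1" for j
  proof -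
    let ?i = "if j < l then j else Suc j"
    have "?i \<in> J" using j l by (auto simp: J_def)
    then have "pick J (card {a\<in>J. a < ?i}) = ?i" by (rule pick_card_in_set)
    moreover have "card {a\<in>J. a < ?i} = j"
    proof (cases "j < l")
      case True
      then have "{a\<in>J. a < ?i} = {..<j}" using j by (auto simp: J_def)
      then show ?thesis by simp
    next
      case False
      then have "{a\<in>J. a < ?i} = {..<Suc j} - {l}" using j by (auto simp: J_def)
      then show ?thesis using False by simp
    qed
    ultimately show ?thesis by (simp only:)
  qed
  have "\<exists>k t. i < n - 1 \<longrightarrow> k < m \<and> \<bar>t\<bar> = 1 \<and> \<rho> (Suc i) = (\<lambda>j. if j < n then t * A $$ (k, j) else 0)" for i
    using \<rho>[of "Suc i"] by (cases "i < n - 1") auto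
  then have "\<forall>i. \<exists>k t. i < n - 1 \<longrightarrow> k < m \<and> \<bar>t\<bar> = 1 \<and> \<rho> (Suc i) = (\<lambda>j. if j < n then t * A $$ (k, j) else 0)" ..
  from choice[OF this] obtain \<tau> where
    "\<forall>i. \<exists>t. i < n - 1 \<longrightarrow> \<tau> i < m \<and> \<bar>t\<bar> = 1 \<and> \<rho> (Suc i) = (\<lambda>j. if j < n then t * A $$ (\<tau> i, j) else 0)" ..
  from choice[OF this] obtain t where "\<forall>i. i < n - 1 \<longrightarrow> \<tau> i < m \<and> \<bar>t i\<bar> = 1 \<and>
      \<rho> (Suc i) = (\<lambda>j. if j < n then t i * A $$ (\<tau> i, j) else 0)" ..
  then have \<tau>: "\<And>i. i < n - 1 \<Longrightarrow> \<tau> i < m" "\<And>i. i < n - 1 \<Longrightarrow> \<bar>t i\<bar> = (1 :: int)"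
     "\<And>i. i < n - 1 \<Longrightarrow> \<rho> (Suc i) = (\<lambda>j. if j < n then t i * A $$ (\<tau> i, j) else 0)"
    by blast+
  have "mat_delete ?M 0 l = mat (n - 1) (n - 1) (\<lambda>(i, j). t i * A $$ (\<tau> i, pick J j))"
    using l \<tau>(3) pickJ by (intro eq_matI) (auto simp: mat_delete_def)
  then have del: "det (mat_delete ?M 0 l) = (\<Prod>i<n - 1. t i) * det (mat (n - 1) (n - 1) (\<lambda>(i, j). A $$ (\<tau> i, pick J j)))"
    by (simp add: det_scale_rows)
  have prod: "\<bar>\<Prod>i<n - 1. t i\<bar> = 1" using \<tau>(2) by (simp add: abs_prod)
  have "rdet n \<rho> = (\<Sum>j<n. ?M $$ (0, j) * cofactor ?M 0 j)"
    unfolding rdet_def by (rule laplace_expansion_row) (use l in auto)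
  also have "\<dots> = (\<Sum>j\<in>{l}. ?M $$ (0, j) * cofactor ?M 0 j)"
    using l \<rho>0 by (intro sum.mono_neutral_right) auto
  also have "\<bar>\<dots>\<bar> = \<bar>det (mat_delete ?M 0 l)\<bar>"
    using l \<rho>0 s by (simp add: abs_mult cofactor_def power_abs)
  also have "\<dots> = \<bar>det (mat (n - 1) (n - 1) (\<lambda>(i, j). A $$ (\<tau> i, pick J j)))\<bar>"
    unfolding del abs_mult prod by simp
  also have "\<dots> \<le> Delta (n - 1) A" by (rule abs_det_rows_le_Delta[OF A J \<tau>(1) m])
  finally show ?thesis .
qed

subsection \<open>Choice of the integer optimum\<close>

text \<open>The vertex property in symmetric form: \<open>x\<close> is not the midpoint of a
  nondegenerate segment in the polyhedron. Rationality of \<open>c\<close> serves the existence of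
  an integer optimum.\<close>

locale integer_program =
  fixes n m :: nat and a :: "nat \<Rightarrow> nat \<Rightarrow> int" and b :: "nat \<Rightarrow> int" and c x :: "nat \<Rightarrow> real"
  assumes feas: "\<And>i. i < m \<Longrightarrow> ip n (rl (a i)) x \<le> real_of_int (b i)"
    and opt: "\<And>y. (\<And>i. i < m \<Longrightarrow> ip n (rl (a i)) y \<le> real_of_int (b i)) \<Longrightarrow> ip n c y \<le> ip n c x"
    and vertex: "\<And>w. (\<And>i. i < m \<Longrightarrow> ip n (rl (a i)) (x + w) \<le> real_of_int (b i)) \<Longrightarrow>
      (\<And>i. i < m \<Longrightarrow> ip n (rl (a i)) (x - w) \<le> real_of_int (b i)) \<Longrightarrow> \<forall>j<n. w j = 0"
    and rational: "\<And>j. j < n \<Longrightarrow> c j \<in> \<rat>"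
begin

definition tight :: "nat \<Rightarrow> bool" where
  "tight i \<longleftrightarrow> ip n (rl (a i)) x = real_of_int (b i)"

definition ifeas :: "(nat \<Rightarrow> int) \<Rightarrow> bool" where
  "ifeas z \<longleftrightarrow> (\<forall>i<m. ip n (rl (a i)) (rl z) \<le> real_of_int (b i))"

definition iopt :: "(nat \<Rightarrow> int) \<Rightarrow> bool" where
  "iopt z \<longleftrightarrow> ifeas z \<and> (\<forall>w. ifeas w \<longrightarrow> ip n c (rl w) \<le> ip n c (rl z))"

text \<open>The finitely many constraints that are not tight have positive slack, so one step length
  serves all of them. The 1 added in the denominator of \<open>r\<close> avoids a division by
  0.\<close>

lemma small_step:
  "\<exists>\<epsilon>>0. \<forall>i<m. \<not> tight i \<longrightarrow> ip n (rl (a i)) x + \<epsilon> * \<bar>ip n (rl (a i)) w\<bar> \<le> real_of_int (b i)"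
proof -
  define r where "r i = (real_of_int (b i) - ip n (rl (a i)) x) / (\<bar>ip n (rl (a i)) w\<bar> + 1)" for i
  define E where "E = insert 1 (r ` {i. i < m \<and> \<not> tight i})"
  have rpos: "r i > 0" if "i < m" "\<not> tight i" for i
    using feas[of i] that unfolding r_def tight_def by (intro divide_pos_pos) auto
  have E: "finite E" "E \<noteq> {}" by (auto simp: E_def)
  have "Min E > 0" using E rpos by (auto simp: E_def)
  moreover have "ip n (rl (a i)) x + Min E * \<bar>ip n (rl (a i)) w\<bar> \<le> real_of_int (b i)"
    if i: "i < m" "\<not> tight i" for i
  proof -
    have "Min E \<le> r i" using E i by (intro Min_le) (auto simp: E_def)
    then have "Min E * (\<bar>ip n (rl (a i)) w\<bar> + 1) \<le> real_of_int (b i) - ip n (rl (a i)) x"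
      unfolding r_def by (subst (asm) pos_le_divide_eq) auto
    then show ?thesis using \<open>Min E > 0\<close> by (simp only: distrib_left mult_1_right)
  qed
  ultimately show ?thesis by blast
qed

text \<open>A direction annihilated by all tight rows could be followed a little both ways from
  \<open>x\<close>, against the vertex property.\<close>

lemma tight_full:
  assumes "\<And>i. i < m \<Longrightarrow> tight i \<Longrightarrow> ip n (rl (a i)) w = 0"
  shows "\<forall>j<n. w j = 0"
proof -
  obtain \<epsilon> where \<epsilon>: "\<epsilon> > 0"
    "\<And>i. i < m \<Longrightarrow> \<not> tight i \<Longrightarrow> ip n (rl (a i)) x + \<epsilon> * \<bar>ip n (rl (a i)) w\<bar> \<le> real_of_int (b i)"
    using small_step by blast
  have le: "ip n (rl (a i)) x + s * ip n (rl (a i)) w \<le> real_of_int (b i)" if "i < m" "\<bar>s\<bar> = \<epsilon>" for i s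
  proof (cases "tight i")
    case True
    then show ?thesis using assms[OF that(1)] feas[OF that(1)] by simp
  next
    case False
    have "s * ip n (rl (a i)) w \<le> \<bar>s\<bar> * \<bar>ip n (rl (a i)) w\<bar>"
      unfolding abs_mult[symmetric] by (rule abs_ge_self)
    then show ?thesis using \<epsilon>(2)[OF that(1) False] that(2) by simp
  qed
  have "\<forall>j<n. (\<epsilon> *\<^sub>R w) j = 0"
    by (rule vertex; use le[of _ \<epsilon>] le[of _ "- \<epsilon>"] \<epsilon>(1) in \<open>simp only: ip_simps; fastforce\<close>)
  then show ?thesis using \<epsilon>(1) by simp
qed

text \<open>Dual feasibility without multipliers: a small step from \<open>x\<close> along
  \<open>- y\<close> is feasible, so it cannot increase the objective.\<close>

lemma objective_nonneg:
  assumes "\<And>i. i < m \<Longrightarrow> tight i \<Longrightarrow> ip n (rl (a i)) y \<ge> 0"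
  shows "ip n c y \<ge> 0"
proof -
  obtain \<epsilon> where \<epsilon>: "\<epsilon> > 0"
    "\<And>i. i < m \<Longrightarrow> \<not> tight i \<Longrightarrow> ip n (rl (a i)) x + \<epsilon> * \<bar>ip n (rl (a i)) y\<bar> \<le> real_of_int (b i)"
    using small_step by blast
  have "ip n c (x - \<epsilon> *\<^sub>R y) \<le> ip n c x"
  proof (rule opt)
    fix i assume i: "i < m"
    show "ip n (rl (a i)) (x - \<epsilon> *\<^sub>R y) \<le> real_of_int (b i)"
    proof (cases "tight i")
      case True
      then have "\<epsilon> * ip n (rl (a i)) y \<ge> 0" using assms[OF i] \<epsilon>(1) by simp
      then show ?thesis using feas[OF i] unfolding ip_simps by linarith
    next
      case False
      have "\<epsilon> * (- ip n (rl (a i)) y) \<le> \<epsilon> * \<bar>ip n (rl (a i)) y\<bar>"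
        using \<epsilon>(1) by (intro mult_left_mono) auto
      then show ?thesis using \<epsilon>(2)[OF i False] unfolding ip_simps by linarith
    qed
  qed
  then have "\<epsilon> * ip n c y \<ge> 0" unfolding ip_simps by linarith
  then show ?thesis using \<epsilon>(1) by (simp add: zero_le_mult_iff)
qed

lemma common_denominator: "\<exists>N>0. \<forall>j<k. j < n \<longrightarrow> (\<exists>p. real_of_int N * c j = real_of_int p)"
proof (induction k)
  case 0
  then show ?case by (intro exI[of _ 1]) auto
next
  case (Suc k)
  then obtain N where N: "N > 0" "\<And>j. j < k \<Longrightarrow> j < n \<Longrightarrow> \<exists>p. real_of_int N * c j = real_of_int p" by blast
  show ?case
  proof (cases "k < n")
    case False
    then show ?thesis using N by (intro exI[of _ N]) (auto simp: less_Suc_eq)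
  next
    case True
    then obtain p q where pq: "q > 0" "c k = real_of_int p / real_of_int q"
      using rational[OF True] by (auto elim!: Rats_cases')
    have "\<exists>p'. real_of_int (N * q) * c j = real_of_int p'" if jj: "j < Suc k" "j < n" for j
    proof (cases "j = k")
      case True
      then have "real_of_int (N * q) * c j = real_of_int (N * p)" using pq by simp
      then show ?thesis by blast
    next
      case False
      then obtain p' where "real_of_int N * c j = real_of_int p'" using N(2)[of j] jj by auto
      then have "real_of_int (N * q) * c j = real_of_int (p' * q)" by (simp add: mult_ac)
      then show ?thesis by blast
    qed
    then show ?thesis using N(1) pq(1) by (intro exI[of _ "N * q"]) auto
  qed
qed

text \<open>Multiplied by a common denominator, the objective is integer-valued on integer points
  and bounded above by its value at \<open>x\<close>; so the maximum is attained.\<close>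

lemma integer_optimum_exists:
  assumes "\<exists>z. ifeas z"
  shows "\<exists>z. iopt z"
proof -
  obtain N where N: "N > 0" "\<And>j. j < n \<Longrightarrow> \<exists>p. real_of_int N * c j = real_of_int p"
    using common_denominator[of n] by auto
  then obtain p where p: "\<And>j. j < n \<Longrightarrow> real_of_int N * c j = real_of_int (p j)" by metis
  define V where "V z = (\<Sum>j<n. p j * z j)" for z
  have V: "real_of_int (V z) = real_of_int N * ip n c (rl z)" for z
    unfolding V_def ip_def of_int_sum sum_distrib_left
    by (intro sum.cong) (auto simp: p[symmetric])
  define B where "B = \<lfloor>real_of_int N * ip n c x\<rfloor>"
  have le: "V z \<le> B" if "ifeas z" for z
  proof -
    have "ip n c (rl z) \<le> ip n c x" using that by (intro opt) (simp add: ifeas_def)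
    then have "real_of_int N * ip n c (rl z) \<le> real_of_int N * ip n c x" using N(1) by simp
    then show ?thesis unfolding B_def le_floor_iff V .
  qed
  obtain z where z: "ifeas z" "\<And>w. ifeas w \<Longrightarrow> nat (B - V z) \<le> nat (B - V w)"
    using ex_has_least_nat[of ifeas _ "\<lambda>z. nat (B - V z)"] assms by blast
  have "ip n c (rl w) \<le> ip n c (rl z)" if "ifeas w" for w
  proof -
    have "V w \<le> V z" using z(2)[OF that] le[OF that] le[OF z(1)] by simp
    then have "real_of_int N * ip n c (rl w) \<le> real_of_int N * ip n c (rl z)"
      unfolding V[symmetric] by simp
    then show ?thesis using N(1) by simp
  qed
  then show ?thesis using z(1) unfolding iopt_def by blast
qed

text \<open>Among the optimal solutions, take one minimising the total slack of the constraints tight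
  at the vertex.\<close>

lemma isolated_optimum_exists:
  assumes "\<exists>z. ifeas z"
  shows "\<exists>z. iopt z \<and> (\<forall>y. (\<forall>i<m. ip n (rl (a i)) (rl y) \<le> real_of_int (b i) - ip n (rl (a i)) (rl z)) \<and>
    (\<forall>i<m. tight i \<longrightarrow> 0 \<le> ip n (rl (a i)) (rl y)) \<longrightarrow> (\<forall>j<n. y j = 0))"
proof -
  define g where "g i z = (\<Sum>j<n. a i j * z j)" for i z
  have g: "ip n (rl (a i)) (rl z) = real_of_int (g i z)" for i z by (simp add: ip_rl g_def del: rl_apply)
  define S where "S z = (\<Sum>i | i < m \<and> tight i. b i - g i z)" for z
  have Spos: "S z \<ge> 0" if "ifeas z" for z
    unfolding S_def using that by (intro sum_nonneg) (auto simp: ifeas_def g simp del: rl_apply)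
  obtain z where z: "iopt z" "\<And>w. iopt w \<Longrightarrow> nat (S z) \<le> nat (S w)"
    using ex_has_least_nat[of iopt _ "\<lambda>z. nat (S z)"] integer_optimum_exists[OF assms] by blast
  have "\<forall>j<n. y j = 0"
    if y: "\<And>i. i < m \<Longrightarrow> ip n (rl (a i)) (rl y) \<le> real_of_int (b i) - ip n (rl (a i)) (rl z)"
      "\<And>i. i < m \<Longrightarrow> tight i \<Longrightarrow> 0 \<le> ip n (rl (a i)) (rl y)" for y
  proof -
    \<comment> \<open>This point is optimal too, since \<open>y\<close> does not lower the
      objective. Minimal slack at \<open>z\<close> forces the nonnegative values of \<open>y\<close>
      on the tight rows to sum to 0, and then \<open>tight_full\<close> gives
      \<open>y = 0\<close>.\<close>
    define w where "w = (\<lambda>j. z j + y j)"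
    have rlw: "rl w = rl z + rl y" by (auto simp: w_def fun_eq_iff)
    have "ifeas w" unfolding ifeas_def rlw ip_add_right using y(1) by force
    moreover have "ip n c (rl w) \<ge> ip n c (rl z)"
      unfolding rlw ip_add_right using objective_nonneg[OF y(2)] by simp
    ultimately have "iopt w" using z(1) unfolding iopt_def by (meson order_trans)
    then have "S z \<le> S w" using z Spos unfolding iopt_def by (metis nat_le_eq_zle order_antisym_conv linorder_linear nat_eq_iff2)
    moreover have "g i w = g i z + g i y" for i by (simp add: g_def w_def algebra_simps sum.distrib)
    then have "S w = S z - (\<Sum>i | i < m \<and> tight i. g i y)"
      unfolding S_def sum_subtractf[symmetric] by (intro sum.cong) auto
    ultimately have le: "(\<Sum>i | i < m \<and> tight i. g i y) \<le> 0" by simp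
    have pos: "g i y \<ge> 0" if "i < m" "tight i" for i using y(2)[OF that] unfolding g by simp
    then have "(\<Sum>i | i < m \<and> tight i. g i y) = 0" using le by (intro antisym sum_nonneg) auto
    then have "g i y = 0" if "i < m" "tight i" for i
      using that pos by (subst (asm) sum_nonneg_eq_0_iff) auto
    then have "\<forall>j<n. rl y j = 0" by (intro tight_full) (simp add: g del: rl_apply)
    then show ?thesis by simp
  qed
  then show ?thesis using z(1) by blast
qed

end

section \<open>Assembly: from the isolated optimum to the coordinatewise bound\<close>

lemma proximity_in_coordinates:
  fixes A :: "int mat"
  assumes n: "2 \<le> n" and A: "A \<in> carrier_mat m n"
    and IP: "integer_program n m (\<lambda>i j. if j < n then A $$ (i, j) else 0) b c x"
    and "\<exists>z. integer_program.ifeas n m (\<lambda>i j. if j < n then A $$ (i, j) else 0) b z"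
  shows "\<exists>z. integer_program.iopt n m (\<lambda>i j. if j < n then A $$ (i, j) else 0) b c z \<and>
    (\<forall>l<n. \<bar>x l - real_of_int (z l)\<bar> < (4 * real n + 2) / 9 * real_of_int (Delta (n - 1) A)) \<and> Delta (n - 1) A > 0"
proof -
  \<comment> \<open>Padding with zeros puts the rows into \<open>supp_in n\<close>.\<close>
  define a where "a = (\<lambda>i j. if j < n then A $$ (i, j) else 0)"
  interpret integer_program n m a b c x using IP unfolding a_def .
  obtain z where z: "iopt z" and iso: "\<And>y. (\<And>i. i < m \<Longrightarrow> ip n (rl (a i)) (rl y) \<le> real_of_int (b i) - ip n (rl (a i)) (rl z)) \<Longrightarrow>
    (\<And>i. i < m \<Longrightarrow> tight i \<Longrightarrow> 0 \<le> ip n (rl (a i)) (rl y)) \<Longrightarrow> (\<forall>j<n. y j = 0)"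
    using isolated_optimum_exists assms(4) unfolding a_def[symmetric] by blast
  define u where "u = x - rl z"
  define s where "s i = (if ip n (rl (a i)) u \<ge> 0 then 1 else - 1 :: int)" for i
  define row where "row i = (\<lambda>j. s i * a i j)" for i
  define RI where "RI = row ` {..<m}"
  have ip_row: "ip n (rl (row i)) w = real_of_int (s i) * ip n (rl (a i)) w" for i w
    by (simp add: ip_def row_def sum_distrib_left mult.assoc)
  have s1: "\<bar>s i\<bar> = 1" "s i \<noteq> 0" "\<bar>real_of_int (s i)\<bar> = 1" for i by (simp_all add: s_def)
  have slack: "ip n (rl (a i)) (rl z) \<le> real_of_int (b i)" if "i < m" for i
    using z that by (simp add: iopt_def ifeas_def del: rl_apply)
  have au: "ip n (rl (a i)) u \<le> real_of_int (b i) - ip n (rl (a i)) (rl z)" if "i < m" for i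
    using feas[OF that] by (simp add: u_def ip_diff_right del: rl_apply)
  have upos: "0 \<le> ip n (rl (row i)) u" for i
    unfolding ip_row by (simp add: s_def del: rl_apply)
  have finRI: "finite RI" by (simp add: RI_def)
  have fullRI: "full n (rl ` RI)"
    unfolding full_def
  proof (rule allI, rule impI)
    fix w assume "\<forall>y\<in>rl ` RI. ip n y w = 0"
    then have "real_of_int (s i) * ip n (rl (a i)) w = 0" if "i < m" for i
      using that unfolding RI_def ip_row[symmetric] by blast
    then show "\<forall>j<n. w j = 0" using s1(2) by (intro tight_full) (simp del: rl_apply)
  qed
  have lf: "\<forall>j<n. y j = 0"
    if f: "\<And>v. v \<in> RI \<Longrightarrow> 0 \<le> ip n (rl v) f \<and> ip n (rl v) f \<le> ip n (rl v) u"
      and t: "0 \<le> t" "t \<le> 1" and q: "\<And>v. v \<in> RI \<Longrightarrow> \<bar>ip n (rl v) q\<bar> < 1"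
      and y: "\<And>j. j < n \<Longrightarrow> rl y j = q j + t * f j" for f y q t
  proof (rule iso)
    have ipy: "ip n (rl (a i)) (rl y) = ip n (rl (a i)) q + t * ip n (rl (a i)) f" for i
    proof -
      have "ip n (rl (a i)) (rl y) = ip n (rl (a i)) (q + t *\<^sub>R f)" using y by (intro ip_cong) simp
      then show ?thesis by (simp only: ip_simps)
    qed
    have aq: "\<bar>ip n (rl (a i)) q\<bar> < 1" if "i < m" for i
      using q[of "row i"] that unfolding ip_row RI_def abs_mult s1(3) by simp
    have f': "0 \<le> real_of_int (s i) * ip n (rl (a i)) f"
      "real_of_int (s i) * ip n (rl (a i)) f \<le> real_of_int (s i) * ip n (rl (a i)) u" if "i < m" for i
      using f[of "row i"] that unfolding ip_row RI_def by blast+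
    fix i assume i: "i < m"
    show "ip n (rl (a i)) (rl y) \<le> real_of_int (b i) - ip n (rl (a i)) (rl z)"
    proof -
      have "ip n (rl (a i)) f \<le> real_of_int (b i) - ip n (rl (a i)) (rl z)"
        using f'[OF i] au[OF i] slack[OF i] by (auto simp: s_def simp del: rl_apply split: if_splits)
      moreover have "t * ip n (rl (a i)) f \<le> max 0 (ip n (rl (a i)) f)"
      proof (cases "ip n (rl (a i)) f \<ge> 0")
        case True
        then show ?thesis using t mult_right_mono[of t 1 "ip n (rl (a i)) f"] by simp
      next
        case False
        then show ?thesis using t mult_nonneg_nonpos[of t "ip n (rl (a i)) f"] by simp
      qed
      \<comment> \<open>The constraint is exceeded by less than 1; as both sides are integers, it is
        not exceeded at all.\<close>
      ultimately have "ip n (rl (a i)) (rl y) < real_of_int (b i) - ip n (rl (a i)) (rl z) + 1"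
        using aq[OF i] slack[OF i] unfolding ipy by linarith
      then have "real_of_int (\<Sum>j<n. a i j * y j) < real_of_int (b i - (\<Sum>j<n. a i j * z j) + 1)"
        unfolding ip_rl by simp
      then have "(\<Sum>j<n. a i j * y j) \<le> b i - (\<Sum>j<n. a i j * z j)"
        unfolding of_int_less_iff by simp
      then have "real_of_int (\<Sum>j<n. a i j * y j) \<le> real_of_int (b i - (\<Sum>j<n. a i j * z j))"
        unfolding of_int_le_iff .
      then show ?thesis unfolding ip_rl of_int_diff .
    qed
    \<comment> \<open>Feasibility of \<open>z\<close> makes tight rows nonnegative on
      \<open>u\<close>, so their sign is not flipped.\<close>
    assume "tight i"
    then have "ip n (rl (a i)) u \<ge> 0" using slack[OF i] by (simp add: tight_def u_def ip_diff_right del: rl_apply)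
    then have "ip n (rl (a i)) f \<ge> 0" using f'(1)[OF i] by (simp add: s_def del: rl_apply)
    then have "ip n (rl (a i)) (rl y) > - 1" using aq[OF i] t unfolding ipy
      by (smt (verit) mult_nonneg_nonneg)
    moreover have "0 \<le> real_of_int k" if "- 1 < real_of_int k" for k
    proof -
      have "real_of_int (- 1) < real_of_int k" using that by simp
      then show ?thesis unfolding of_int_less_iff by simp
    qed
    ultimately show "0 \<le> ip n (rl (a i)) (rl y)" unfolding ip_rl by blast
  qed
  have supp_row: "rl v \<in> supp_in n" if "v \<in> RI" for v
    using that by (auto simp: RI_def row_def supp_in_def a_def)
  define e where "e l t = (\<lambda>j. if j = l then t else 0 :: int)" for l :: nat and t
  have ipe: "ip n (rl (e l t)) w = real_of_int t * w l" if "l < n" for l t w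
  proof -
    have "ip n (rl (e l t)) w = (\<Sum>j<n. if j = l then real_of_int t * w j else 0)"
      unfolding ip_def by (intro sum.cong) (auto simp: e_def)
    then show ?thesis using that by simp
  qed
  \<comment> \<open>With fewer rows, \<open>Delta (n - 1) A\<close> would be a maximum over the
    empty set.\<close>
  have m: "n - 1 \<le> m"
  proof -
    have "n \<le> dim (rl ` RI)" using finRI fullRI by (intro full_imp_dim_ge) auto
    also have "\<dots> \<le> card (rl ` RI)" using finRI by (intro dim_le_card) (auto intro: span_base)
    also have "\<dots> \<le> m"
      using card_image_le[of RI rl] card_image_le[of "{..<m}" row] finRI by (simp add: RI_def)
    finally show ?thesis by simp
  qed
  have minors: "\<bar>rdet n \<rho>\<bar> \<le> Delta (n - 1) A"
    if \<rho>: "\<rho> 0 = e l t" "\<And>i. 0 < i \<Longrightarrow> i < n \<Longrightarrow> \<rho> i \<in> RI" "l < n" "\<bar>t\<bar> = 1" for \<rho> l t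
  proof (rule abs_rdet_le_Delta[OF A \<rho>(3) m \<rho>(4)])
    show "\<rho> 0 = (\<lambda>j. if j = l then t else 0)" using \<rho>(1) by (simp add: e_def)
    fix i assume "0 < i" "i < n"
    then obtain k where k: "k < m" "\<rho> i = row k" using \<rho>(2) by (auto simp: RI_def)
    then have "\<rho> i = (\<lambda>j. if j < n then s k * A $$ (k, j) else 0)" by (auto simp: row_def a_def)
    then show "\<exists>k<m. \<exists>t. \<bar>t\<bar> = 1 \<and> \<rho> i = (\<lambda>j. if j < n then t * A $$ (k, j) else 0)"
      using k(1) s1(1) by blast
  qed
  have supp: "rl v \<in> supp_in n" if "v \<in> insert (e l t) RI" "l < n" for v l t
    using that supp_row by (auto simp: e_def supp_in_def)
  have Dpos: "Delta (n - 1) A > 0"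
  proof -
    \<comment> \<open>A unit vector completed by rows to a basis exhibits a nonzero minor; taking it
      also as \<open>f\<close> ensures the positivity that the locale asks for.\<close>
    interpret bounded_minors n RI "e 0 1" "rl (e 0 1)" "Delta (n - 1) A"
    proof
      show "ip n (rl (e 0 1)) (rl (e 0 1)) > 0" using n by (subst ipe) (auto simp: e_def)
      show "rl v \<in> supp_in n" if "v \<in> insert (e 0 1) RI" for v using supp[OF that] n by simp
      show "\<bar>rdet n \<rho>\<bar> \<le> Delta (n - 1) A" if "\<rho> 0 = e 0 1" "\<And>i. 0 < i \<Longrightarrow> i < n \<Longrightarrow> \<rho> i \<in> RI" for \<rho>
        using minors[of \<rho> 0 1] that n by simp
    qed (fact finRI fullRI)+
    show ?thesis using Delta_pos n by simp
  qed
  have bound: "real_of_int t * u l < (4 * real n + 2) / 9 * real_of_int (Delta (n - 1) A)"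
    if lt: "l < n" "\<bar>t\<bar> = 1" for l t
  proof -
    have "ip n (rl (e l t)) u < (4 * real n + 2) / 9 * real_of_int (Delta (n - 1) A)"
    \<comment> \<open>Applied to the whole of \<open>u\<close> with \<open>d = n\<close>, where the
      rank condition is vacuous; the two signs of \<open>t\<close> give the absolute value.\<close>
    proof (rule gap_bound[where u = u])
      show "rl v \<in> supp_in n" if "v \<in> insert (e l t) RI" for v using supp[OF that lt(1)] .
      show "\<bar>rdet n \<rho>\<bar> \<le> Delta (n - 1) A" if "\<rho> 0 = e l t" "\<And>i. 0 < i \<Longrightarrow> i < n \<Longrightarrow> \<rho> i \<in> RI" for \<rho>
        using minors[of \<rho> l t] that lt by blast
      show "0 \<le> ip n (rl v) u \<and> ip n (rl v) u \<le> ip n (rl v) u" if "v \<in> RI" for v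
        using that upos by (auto simp: RI_def simp del: rl_apply)
    qed (use finRI fullRI lf Dpos n in \<open>blast | simp\<close>)+
    then show ?thesis unfolding ipe[OF lt(1)] .
  qed
  have "\<bar>x l - real_of_int (z l)\<bar> < (4 * real n + 2) / 9 * real_of_int (Delta (n - 1) A)" if "l < n" for l
  proof -
    have "u l < (4 * real n + 2) / 9 * real_of_int (Delta (n - 1) A)"
      using bound[OF that, of 1] by (simp only: of_int_1 mult_1 abs_1 simp_thms)
    moreover have "- u l < (4 * real n + 2) / 9 * real_of_int (Delta (n - 1) A)"
      using bound[OF that, of "- 1"]
      by (simp only: of_int_minus of_int_1 mult_minus1 abs_minus_cancel abs_1 simp_thms)
    moreover have "x l - real_of_int (z l) = u l" by (simp add: u_def)
    ultimately show ?thesis by linarith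
  qed
  then show ?thesis using z Dpos unfolding a_def by blast
qed

theorem theorem2:
  fixes A :: "int mat" and b :: "int vec" and c :: "rat vec" and xs :: "real vec"
    and m n :: nat
  assumes "n \<ge> 2"
    and "A \<in> carrier_mat m n" and "b \<in> carrier_vec m" and "c \<in> carrier_vec n"
    and "vec_space.rank m (map_mat real_of_int A) = n"
    and "is_vertex (polyhedron A b) xs" and "lp_optimal A b c xs"
    and "\<exists>z. ip_feasible A b z"
  shows "\<exists>zs. ip_optimal A b c zs \<and>
           linf_norm (xs - map_vec real_of_int zs)
             < (4 * real n + 2) / 9 * real_of_int (Delta (n - 1) A)"
proof -
  note A = assms(2) and b = assms(3) and c = assms(4)
  define a where "a = (\<lambda>i j. if j < n then A $$ (i, j) else 0)"
  define cf where "cf j = real_of_rat (c $ j)" for j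
  define x where "x j = xs $ j" for j
  have dims: "dim_row A = m" "dim_col A = n" using A by auto
  have Av: "(map_mat real_of_int A *\<^sub>v v) $ i = ip n (rl (a i)) (\<lambda>j. v $ j)"
    if "i < m" "v \<in> carrier_vec n" for i v
    using that A by (simp add: ip_def a_def scalar_prod_def atLeast0LessThan)
  have poly: "v \<in> polyhedron A b \<longleftrightarrow> v \<in> carrier_vec n \<and> (\<forall>i<m. ip n (rl (a i)) (\<lambda>j. v $ j) \<le> real_of_int (b $ i))" for v
    unfolding polyhedron_def dims using Av by auto
  have obj: "map_vec real_of_rat c \<bullet> v = ip n cf (\<lambda>j. v $ j)" if "v \<in> carrier_vec n" for v
    using that c by (simp add: scalar_prod_def ip_def cf_def atLeast0LessThan)
  have xP: "xs \<in> polyhedron A b" using assms(7) by (simp add: lp_optimal_def)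
  then have xs: "xs \<in> carrier_vec n" by (simp add: poly)
  have vecfun: "ip n v (\<lambda>j. vec n w $ j) = ip n v w" for v w by (intro ip_cong) simp
  interpret integer_program n m a "\<lambda>i. b $ i" cf x
  proof
    show "ip n (rl (a i)) x \<le> real_of_int (b $ i)" if "i < m" for i
      using xP that unfolding poly x_def by blast
    show "ip n cf y \<le> ip n cf x" if "\<And>i. i < m \<Longrightarrow> ip n (rl (a i)) y \<le> real_of_int (b $ i)" for y
    proof -
      have "vec n y \<in> polyhedron A b" unfolding poly vecfun using that by simp
      then have "map_vec real_of_rat c \<bullet> vec n y \<le> map_vec real_of_rat c \<bullet> xs"
        using assms(7) by (simp add: lp_optimal_def)
      then show ?thesis unfolding obj[OF xs] obj[OF vec_carrier] vecfun x_def .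
    qed
    show "\<forall>j<n. w j = 0"
      if w: "\<And>i. i < m \<Longrightarrow> ip n (rl (a i)) (x + w) \<le> real_of_int (b $ i)"
        "\<And>i. i < m \<Longrightarrow> ip n (rl (a i)) (x - w) \<le> real_of_int (b $ i)" for w
    proof (rule ccontr)
      assume "\<not> (\<forall>j<n. w j = 0)"
      then obtain j where j: "j < n" "w j \<noteq> 0" by blast
      have mem: "vec n (x + w) \<in> polyhedron A b" "vec n (x - w) \<in> polyhedron A b"
        unfolding poly vecfun using w by simp_all
      have "vec n (x + w) $ j \<noteq> vec n (x - w) $ j" using j by simp
      then have "vec n (x + w) \<noteq> vec n (x - w)" by metis
      moreover have "xs = (1 / 2) \<cdot>\<^sub>v vec n (x + w) + (1 - 1 / 2) \<cdot>\<^sub>v vec n (x - w)"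
        using xs by (intro eq_vecI) (auto simp: x_def field_simps)
      moreover have "(0 :: real) < 1 / 2 \<and> 1 / 2 < (1 :: real)" by simp
      ultimately show False using assms(6) mem unfolding is_vertex_def by blast
    qed
    show "cf j \<in> \<rat>" for j by (simp add: cf_def)
  qed
  have ifeas: "ip_feasible A b z \<longleftrightarrow> z \<in> carrier_vec n \<and> ifeas (\<lambda>j. z $ j)" for z
  proof (cases "z \<in> carrier_vec n")
    case True
    have "ip n v (\<lambda>j. map_vec real_of_int z $ j) = ip n v (rl (\<lambda>j. z $ j))" for v
      using True by (intro ip_cong) simp
    then show ?thesis using True by (simp add: ip_feasible_def dims poly ifeas_def del: rl_apply)
  qed (simp add: ip_feasible_def dims)
  have "\<exists>z. ifeas z" using assms(8) ifeas by blast
  then obtain z where z: "iopt z" "Delta (n - 1) A > 0"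
    "\<And>l. l < n \<Longrightarrow> \<bar>x l - real_of_int (z l)\<bar> < (4 * real n + 2) / 9 * real_of_int (Delta (n - 1) A)"
    using proximity_in_coordinates[OF assms(1) A, of "\<lambda>i. b $ i" cf x] integer_program_axioms unfolding a_def by blast
  define zs where "zs = vec n z"
  have zs: "zs \<in> carrier_vec n" by (simp add: zs_def)
  have objz: "map_vec real_of_rat c \<bullet> map_vec real_of_int w = ip n cf (rl (\<lambda>j. w $ j))" if "w \<in> carrier_vec n" for w
    using that by (subst obj) (auto intro: ip_cong)
  have zsz: "ip n v (rl (\<lambda>j. zs $ j)) = ip n v (rl z)" for v by (intro ip_cong) (simp add: zs_def)
  have "ip_optimal A b c zs"
    unfolding ip_optimal_def
  proof (intro conjI allI impI)
    show "ip_feasible A b zs" using z(1) zs by (simp add: ifeas iopt_def ifeas_def zsz del: rl_apply)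
    fix w assume "ip_feasible A b w"
    then have w: "w \<in> carrier_vec n" "ifeas (\<lambda>j. w $ j)" by (simp_all add: ifeas)
    show "map_vec real_of_rat c \<bullet> map_vec real_of_int w \<le> map_vec real_of_rat c \<bullet> map_vec real_of_int zs"
      unfolding objz[OF w(1)] objz[OF zs] zsz using z(1) w(2) unfolding iopt_def by blast
  qed
  moreover have "linf_norm (xs - map_vec real_of_int zs) < (4 * real n + 2) / 9 * real_of_int (Delta (n - 1) A)"
    unfolding linf_norm_def
  proof (subst Max_less_iff)
    let ?S = "{\<bar>(xs - map_vec real_of_int zs) $ i\<bar> | i. i < dim_vec (xs - map_vec real_of_int zs)}"
    have "?S = (\<lambda>i. \<bar>(xs - map_vec real_of_int zs) $ i\<bar>) ` {..<dim_vec (xs - map_vec real_of_int zs)}" by blast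
    then show "finite (insert 0 ?S)" by simp
    \<comment> \<open>The 0 inserted in \<open>linf_norm\<close> is covered by positivity of
      \<open>Delta (n - 1) A\<close>.\<close>
    show "\<forall>r\<in>insert 0 ?S. r < (4 * real n + 2) / 9 * real_of_int (Delta (n - 1) A)"
      using z(2,3) xs zs by (auto simp: x_def zs_def)
  qed auto
  ultimately show ?thesis by blast
qed

end
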